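(* Let $n\ge1$, $1\le p<\infty$, $1<q<\infty$ and let $w$ be a weight on $\mathbb{R}^{n+1}$. Assume that there exists a constant $C_1>0$ such that for every parabolic rectangle $R\subset\mathbb{R}^{n+1}$ we have $$\biggl(\frac1{|R^-|}\int_{R^-}w^q\,dx\,dt\biggr)^{1/q}\le C_1\,\frac1{|R^+|}\int_{R^+}w\,dx\,dt.$$ Then there exist $\varepsilon>0$ and $C>0$, depending only on $n,p,q,C_1$, such that for every parabolic rectangle $R\subset\mathbb{R}^{n+1}$ we have $$\biggl(\frac1{|R^-|}\int_{R^-}w^{q+\varepsilon}\,dx\,dt\biggr)^{1/(q+\varepsilon)}\le C\,\frac1{|R^+|}\int_{R^+}w\,dx\,dt.$$
   Context: Points of $\mathbb{R}^{n+1}$ are written $(x,t)$ with $x\in\mathbb{R}^n$, $t\in\mathbb{R}$. For $x\in\mathbb{R}^n$, $t\in\mathbb{R}$, $L>0$ let $Q(x,L)=\{y\in\mathbb{R}^n:|y_i-x_i|\le L/2,\ i=1,\dots,n\}$. A parabolic rectangle is a set $R=R(x,t,L)=Q(x,L)\times(t-L^p,t+L^p)$; its upper and lower parts are $R^+=Q(x,L)\times(t,t+L^p)$ and $R^-=Q(x,L)\times(t-L^p,t)$. A weight is a locally integrable nonnegative function on $\mathbb{R}^{n+1}$. $|A|$ denotes Lebesgue measure. *)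

theory Defs
  imports "HOL-Analysis.Analysis"
begin

text \<open>Points of the $(n+1)$-dimensional space are pairs \<open>(x, t) :: (real ^ 'n) \<times> real\<close>,
  with \<open>n = CARD('n) \<ge> 1\<close>.\<close>

definition cube :: "real ^ 'n \<Rightarrow> real \<Rightarrow> (real ^ 'n) set" where
  "cube x L = {y. \<forall>i. \<bar>y $ i - x $ i\<bar> \<le> L / 2}"

text \<open>The upper part \<open>R\<^sup>+\<close> and the lower part \<open>R\<^sup>-\<close> of the parabolic rectangle
  \<open>R(x, t, L) = cube x L \<times> {t - L powr p <..< t + L powr p}\<close>. A parabolic rectangle is always
  taken with \<open>L > 0\<close>.\<close>

definition upper_part :: "real \<Rightarrow> real ^ 'n \<Rightarrow> real \<Rightarrow> real \<Rightarrow> ((real ^ 'n) \<times> real) set" where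
  "upper_part p x t L = cube x L \<times> {t <..< t + L powr p}"

definition lower_part :: "real \<Rightarrow> real ^ 'n \<Rightarrow> real \<Rightarrow> real \<Rightarrow> ((real ^ 'n) \<times> real) set" where
  "lower_part p x t L = cube x L \<times> {t - L powr p <..< t}"

text \<open>Local integrability includes Lebesgue measurability.\<close>

definition weight :: "((real ^ 'n) \<times> real \<Rightarrow> real) \<Rightarrow> bool" where
  "weight w \<longleftrightarrow> (\<forall>z. 0 \<le> w z) \<and> (\<forall>K. compact K \<longrightarrow> set_integrable lebesgue K w)"

text \<open>Averages of nonnegative functions are taken in \<^typ>\<open>ennreal\<close>, since the integral of a power
  of a weight may be infinite; an upper bound by a finite quantity thus includes finiteness.
  (With the Bochner integral a divergent integral would be \<open>0\<close>.)\<close>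

definition average :: "'a::euclidean_space set \<Rightarrow> ('a \<Rightarrow> real) \<Rightarrow> ennreal" where
  "average A f = (\<integral>\<^sup>+z\<in>A. ennreal (f z) \<partial>lebesgue) / emeasure lebesgue A"

text \<open>Real powers on \<^typ>\<open>ennreal\<close>, only meant for exponents \<open>a > 0\<close>.\<close>

definition ennreal_powr :: "ennreal \<Rightarrow> real \<Rightarrow> ennreal" where
  "ennreal_powr x a = (if x = \<infinity> then \<infinity> else ennreal (enn2real x powr a))"

end

theory Submission
  imports Defs
begin

text \<open>Gehring's lemma, arranged so that only the future is used. On a dyadic grid in space,
  refined in time so that cells are comparable to lower parts of parabolic rectangles, stop at the
  first cell on which the mean of \<open>w\<^sup>q\<close> exceeds \<open>\<Lambda>\<^sup>q\<close>. The reverse Hoelder inequality transports the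
  largeness to the upper part above the cell, and a Vitali selection of disjoint upper parts bounds
  the integral of \<open>w\<^sup>q\<close> over \<open>{w > \<Lambda>}\<close> by a constant times \<open>\<Lambda> powr (q - 1)\<close> times the integral
  of \<open>w\<close> over \<open>{w > c \<Lambda>}\<close>. The upper parts lie over the same cubes, so nothing leaks out sideways;
  they do leak forward in time, but stopped cells at level \<open>2\<^sup>j \<lambda>\<close> have geometrically small height,
  so level sets inside boxes shrinking down to \<open>R\<^sup>-\<close> suffice. Multiplying by
  \<open>(2\<^sup>j \<lambda>) powr \<epsilon>\<close> and summing over \<open>j\<close>, the right-hand side is absorbed for small \<open>\<epsilon>\<close>.\<close>

section \<open>Stopping times\<close>

text \<open>The hypothesis compares two disjoint sets, the later one on the right, so a level set
  estimate inside one fixed set does not close up: each transport moves forward in time. The drift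
  is tamed by counting generations. One generation divides the volume of a cell by at most 2^(n +
  ceil p), while level \<open>j\<close> demands a mean of w^q above 2^(j q) lam^q; so a stopped cell
  lies more than \<open>b * j\<close> generations below \<open>k0\<close>, where
  \<open>b = q / (n + ceil p)\<close>. The drifts form a geometric series, and \<open>k0\<close> is
  taken so large that it fits into half of the upper part. The price is an a priori bound for w^q on
  a set reaching into R^+, where the hypothesis for R itself gives none; small rectangles whose
  upper parts still lie in R^+ provide it. Absorption works because of
  \<open>\<epsilon> = 1 / N0\<close>: at a given point the levels on the right sum up to a constant
  times the top one, while on the left about \<open>N0\<close> levels below the top have weights
  equal up to a factor 2. This gains a factor 1 / N0. The sum is cut off at finitely many levels, so
  that what is absorbed is finite.\<close>

declare emeasure_completion [simp del]

text \<open>Continuity from below along an enumeration of \<open>F\<close>. It allows the Vitali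
  selection to be run on finite families only.\<close>

lemma emeasure_Union_le_if_finite:
  assumes "countable F" and "F \<subseteq> sets M"
    and "\<And>G. finite G \<Longrightarrow> G \<subseteq> F \<Longrightarrow> emeasure M (\<Union>G) \<le> c"
  shows "emeasure M (\<Union>F) \<le> c"
proof (cases "F = {}")
  case False
  define e where "e = from_nat_into F"
  have re: "range e = F"
    unfolding e_def using False assms(1) by (rule range_from_nat_into)
  define U where "U n = \<Union>(e ` {..n})" for n :: nat
  have eF: "e ` {..n} \<subseteq> F" for n using re by auto
  have "emeasure M (\<Union>n. U n) = (SUP n. emeasure M (U n))"
  proof (rule SUP_emeasure_incseq[symmetric])
    show "range U \<subseteq> sets M"
      unfolding U_def using assms(2) eF by (auto intro!: sets.finite_UN)
    show "incseq U"
      unfolding U_def by (intro monoI Union_mono image_mono) simp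
  qed
  also have "\<dots> \<le> c"
    by (rule SUP_least) (use assms(3) eF in \<open>auto simp: U_def\<close>)
  finally have "emeasure M (\<Union>n. U n) \<le> c" .
  moreover have "(\<Union>n. U n) = \<Union>F"
    unfolding U_def re[symmetric] by auto
  ultimately show ?thesis by simp
qed simp

text \<open>Greedy Vitali selection: keep an index \<open>m\<close> of least \<open>g\<close>,
  discard everything that meets it, recurse on the rest. Here \<open>g\<close> will be the
  generation, so least means largest set. An empty \<open>st i\<close> meets nothing, not even
  itself, hence the exception.\<close>

lemma finite_disjoint_subfamily:
  fixes g :: "'i \<Rightarrow> nat" and st :: "'i \<Rightarrow> 'a set"
  assumes "finite I"
  shows "\<exists>J\<subseteq>I. disjoint_family_on st J
    \<and> (\<forall>i\<in>I. st i \<noteq> {} \<longrightarrow> (\<exists>j\<in>J. g j \<le> g i \<and> st i \<inter> st j \<noteq> {}))"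
  using assms
proof (induction "card I" arbitrary: I rule: less_induct)
  case less
  show ?case
  proof (cases "I = {}")
    case True
    then show ?thesis by (auto simp: disjoint_family_on_def)
  next
    case False
    then obtain m where m: "m \<in> I" "\<And>i. i \<in> I \<Longrightarrow> g m \<le> g i"
      using less.prems by (metis arg_min_if_finite(1) arg_min_least)
    define I' where "I' = {i\<in>I. i \<noteq> m \<and> st i \<inter> st m = {}}"
    have "I' \<subset> I" using m(1) by (auto simp: I'_def)
    then have "card I' < card I" "finite I'"
      using less.prems by (auto intro: psubset_card_mono finite_subset)
    from less.hyps[OF this] obtain J where J: "J \<subseteq> I'" "disjoint_family_on st J"
      "\<forall>i\<in>I'. st i \<noteq> {} \<longrightarrow> (\<exists>j\<in>J. g j \<le> g i \<and> st i \<inter> st j \<noteq> {})"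
      by blast
    have "insert m J \<subseteq> I" using J(1) m(1) by (auto simp: I'_def)
    moreover have "disjoint_family_on st (insert m J)"
      using J(1,2) by (fastforce simp: disjoint_family_on_def I'_def)
    moreover have "\<exists>j\<in>insert m J. g j \<le> g i \<and> st i \<inter> st j \<noteq> {}"
      if "i \<in> I" "st i \<noteq> {}" for i
    proof (cases "i \<in> I'")
      case True
      then show ?thesis using J(3) that by auto
    next
      case False
      then show ?thesis using that m by (auto simp: I'_def)
    qed
    ultimately show ?thesis by blast
  qed
qed

text \<open>The label of a coarse half-open interval is a function of the label of any fine one
  obtained by an integer subdivision. This is the nesting of the grid in one coordinate.\<close>

lemma ceiling_mult_div:
  fixes y c :: real
  assumes "c = real n" and "0 < n"
  shows "\<lceil>of_int \<lceil>y * c\<rceil> / c\<rceil> = \<lceil>y\<rceil>"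
proof (rule ceiling_unique)
  have c: "c > 0" using assms by simp
  have "y * c \<le> of_int \<lceil>y * c\<rceil>" by simp
  then have "y \<le> of_int \<lceil>y * c\<rceil> / c" using c by (simp add: field_simps)
  then show "of_int \<lceil>y\<rceil> - 1 < of_int \<lceil>y * c\<rceil> / c" by linarith
  have "y * c \<le> of_int \<lceil>y\<rceil> * c" using c by (intro mult_right_mono) auto
  also have "\<dots> = of_int (\<lceil>y\<rceil> * int n)" using assms by simp
  finally have "\<lceil>y * c\<rceil> \<le> \<lceil>y\<rceil> * int n" by (simp only: ceiling_le_iff)
  then have "of_int \<lceil>y * c\<rceil> \<le> of_int \<lceil>y\<rceil> * c"
    using assms by (metis of_int_le_iff of_int_mult of_int_of_nat_eq)
  then show "of_int \<lceil>y * c\<rceil> / c \<le> of_int \<lceil>y\<rceil>" using c by (simp add: field_simps)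
qed

lemma ceiling_eq_coarser:
  fixes y y' :: real
  assumes "0 < n" and "\<lceil>y * real n\<rceil> = \<lceil>y' * real n\<rceil>"
  shows "\<lceil>y\<rceil> = \<lceil>y'\<rceil>"
  using ceiling_mult_div[OF refl assms(1)] assms(2) by metis

text \<open>A nested sequence of partitions encoded by labels: cells are fibres of
  \<open>idx k\<close>, so cells of one generation are disjoint automatically, and the countable
  label type makes all cells countably many.\<close>

locale filtration =
  fixes idx :: "nat \<Rightarrow> 'a::euclidean_space \<Rightarrow> 'i::countable"
  assumes idx_Suc: "idx (Suc k) y = idx (Suc k) z \<Longrightarrow> idx k y = idx k z"
    and idx_sets: "{y. idx k y = v} \<in> sets lebesgue"
    and idx_shrink: "open G \<Longrightarrow> z \<in> G \<Longrightarrow> \<exists>k\<ge>k0. {y. idx k y = idx k z} \<subseteq> G"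
begin

definition cell :: "nat \<Rightarrow> 'a \<Rightarrow> 'a set" where
  "cell k z = {y. idx k y = idx k z}"

lemma mem_cell: "z \<in> cell k z" by (simp add: cell_def)

lemma cell_sets [measurable]: "cell k z \<in> sets lebesgue"
  unfolding cell_def by (rule idx_sets)

lemma idx_mono:
  assumes "k \<le> k'" and "idx k' y = idx k' z"
  shows "idx k y = idx k z"
  using assms by (induction rule: dec_induct) (auto intro: idx_Suc)

lemma cell_mono: "k \<le> k' \<Longrightarrow> cell k' z \<subseteq> cell k z"
  unfolding cell_def using idx_mono by blast

lemma countable_cells: "countable {cell k z | k z. True}"
proof -
  have "{cell k z | k z. True} \<subseteq> (\<lambda>(k, v). {y. idx k y = v}) ` UNIV"
    by (auto simp: cell_def image_iff)
  then show ?thesis by (rule countable_subset) simp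
qed

text \<open>The stopping time argument: every point of \<open>E\<close> is put into the first cell of its chain that
  satisfies \<open>P\<close>, and these cells are pairwise disjoint.\<close>

lemma stopping_cover:
  assumes sets_mu: "sets \<mu> = sets lebesgue"
    and ex: "\<And>z. z \<in> E \<Longrightarrow> \<exists>k\<ge>k0. P (cell k z)"
    and first: "\<And>z k. z \<in> E \<Longrightarrow> k0 \<le> k \<Longrightarrow> P (cell k z) \<Longrightarrow>
      (\<And>i. k0 \<le> i \<Longrightarrow> i < k \<Longrightarrow> \<not> P (cell i z)) \<Longrightarrow>
      emeasure \<mu> (cell k z) \<le> c * emeasure lebesgue (cell k z)"
    and bound: "\<And>G. finite G \<Longrightarrow> G \<subseteq> {cell k z | k z. k0 \<le> k \<and> z \<in> E \<and> P (cell k z)} \<Longrightarrow>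
      emeasure lebesgue (\<Union>G) \<le> B"
  obtains U where "U \<in> sets lebesgue" "E \<subseteq> U" "emeasure \<mu> U \<le> c * B"
proof -
  define \<kappa> where "\<kappa> z = (LEAST k. k0 \<le> k \<and> P (cell k z))" for z
  have \<kappa>: "k0 \<le> \<kappa> z" "P (cell (\<kappa> z) z)" if "z \<in> E" for z
  proof -
    have "k0 \<le> \<kappa> z \<and> P (cell (\<kappa> z) z)"
      unfolding \<kappa>_def by (rule LeastI_ex[OF ex[OF that]])
    then show "k0 \<le> \<kappa> z" "P (cell (\<kappa> z) z)" by simp_all
  qed
  have \<kappa>_least: "\<not> P (cell i z)" if "k0 \<le> i" "i < \<kappa> z" for i z
    using not_less_Least that unfolding \<kappa>_def by blast
  define F where "F = (\<lambda>z. cell (\<kappa> z) z) ` E"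
  \<comment> \<open>If two first cells meet, the coarser one also belongs to the chain of the other
    point. It satisfies \<open>P\<close>, so minimality forbids the other point to stop strictly
    later.\<close>
  have key: "cell (\<kappa> z) z = cell (\<kappa> z') z'"
    if "z \<in> E" "z' \<in> E" "y \<in> cell (\<kappa> z) z" "y \<in> cell (\<kappa> z') z'" "\<kappa> z \<le> \<kappa> z'" for z z' y
  proof -
    have "idx (\<kappa> z) y = idx (\<kappa> z) z'"
      using that(4,5) idx_mono unfolding cell_def by blast
    then have eq: "cell (\<kappa> z) z' = cell (\<kappa> z) z"
      using that(3) unfolding cell_def by auto
    then have "\<not> \<kappa> z < \<kappa> z'"
      using \<kappa>[OF that(1)] \<kappa>_least[of "\<kappa> z" z'] by auto
    then show ?thesis using eq that(5) by (simp add: le_less)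
  qed
  have disj: "disjoint F"
  proof (rule disjointI)
    fix S S' assume S: "S \<in> F" "S' \<in> F" "S \<noteq> S'"
    then obtain z z' where z: "z \<in> E" "z' \<in> E" "S = cell (\<kappa> z) z" "S' = cell (\<kappa> z') z'"
      by (auto simp: F_def)
    show "S \<inter> S' = {}"
    proof (rule ccontr)
      assume "S \<inter> S' \<noteq> {}"
      then obtain y where "y \<in> S" "y \<in> S'" by auto
      then have "S = S'"
        using key[of z z' y] key[of z' z y] z by (metis nat_le_linear)
      then show False using S by simp
    qed
  qed
  have F_sets: "F \<subseteq> sets lebesgue" by (auto simp: F_def)
  have "countable F"
    by (rule countable_subset[OF _ countable_cells]) (auto simp: F_def)
  have "emeasure \<mu> (\<Union>F) \<le> c * B"
  proof (rule emeasure_Union_le_if_finite)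
    fix G assume G: "finite G" "G \<subseteq> F"
    have dG: "disjoint G" using disj G(2) by (rule pairwise_subset)
    have "emeasure \<mu> (\<Union>G) = (\<Sum>S\<in>G. emeasure \<mu> S)"
      using G dG F_sets sets_mu sum_emeasure[of "\<lambda>x. x" G \<mu>]
      by (auto simp: disjoint_def disjoint_family_on_def)
    also have "\<dots> \<le> (\<Sum>S\<in>G. c * emeasure lebesgue S)"
    proof (rule sum_mono)
      fix S assume "S \<in> G"
      then obtain z where "z \<in> E" "S = cell (\<kappa> z) z" using G(2) by (auto simp: F_def)
      then show "emeasure \<mu> S \<le> c * emeasure lebesgue S"
        using first \<kappa> \<kappa>_least by auto
    qed
    also have "\<dots> = c * (\<Sum>S\<in>G. emeasure lebesgue S)" by (simp add: sum_distrib_left)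
    also have "(\<Sum>S\<in>G. emeasure lebesgue S) = emeasure lebesgue (\<Union>G)"
      using G dG F_sets sum_emeasure[of "\<lambda>x. x" G lebesgue]
      by (auto simp: disjoint_def disjoint_family_on_def)
    also have "c * \<dots> \<le> c * B"
    proof (rule mult_left_mono)
      show "emeasure lebesgue (\<Union>G) \<le> B"
      proof (rule bound[OF G(1)])
        have "F \<subseteq> {cell k z |k z. k0 \<le> k \<and> z \<in> E \<and> P (cell k z)}"
          unfolding F_def using \<kappa> by blast
        then show "G \<subseteq> {cell k z |k z. k0 \<le> k \<and> z \<in> E \<and> P (cell k z)}"
          using G(2) by simp
      qed
    qed simp
    finally show "emeasure \<mu> (\<Union>G) \<le> c * B" .
  qed (use \<open>countable F\<close> F_sets sets_mu in auto)
  moreover have "E \<subseteq> \<Union>F" using mem_cell by (fastforce simp: F_def)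
  moreover have "\<Union>F \<in> sets lebesgue"
    using \<open>countable F\<close> F_sets by (auto intro: sets.countable_Union)
  ultimately show ?thesis using that by blast
qed

text \<open>The part of Lebesgue differentiation that is needed, by covering alone. On the
  exceptional set \<open>E\<close> all late cells have mean at most \<open>c\<close>; covering
  \<open>E\<close> by such cells inside an open set barely larger than \<open>E\<close> gives
  \<open>emeasure \<mu> E \<le> c * emeasure lebesgue E\<close>, which is incompatible with
  \<open>f > c\<close> on \<open>E\<close> unless \<open>E\<close> is null.\<close>

lemma AE_cell_average_gt:
  fixes f :: "'a \<Rightarrow> real" and c :: real
  assumes [measurable]: "f \<in> borel_measurable lebesgue" "A \<in> sets lebesgue"
    and fin: "emeasure lebesgue A < \<infinity>" and "0 \<le> c" and f: "\<And>z. z \<in> A \<Longrightarrow> c < f z"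
  shows "AE z in lebesgue. z \<in> A \<longrightarrow> (\<exists>k\<ge>k0.
    ennreal c * emeasure lebesgue (cell k z)
      < emeasure (density lebesgue (\<lambda>z. ennreal (f z))) (cell k z))"
proof -
  define \<mu> where "\<mu> = density lebesgue (\<lambda>z. ennreal (f z))"
  have s\<mu>: "sets \<mu> = sets lebesgue" by (simp add: \<mu>_def)
  define bad where "bad k = {z. ennreal c * emeasure lebesgue (cell k z) < emeasure \<mu> (cell k z)}" for k
  have [measurable]: "bad k \<in> sets lebesgue" for k
  proof -
    have "bad k = (\<Union>v\<in>idx k ` bad k. {y. idx k y = v})"
      by (auto simp: bad_def cell_def)
    also have "\<dots> \<in> sets lebesgue"
      by (rule sets.countable_UN') (auto intro: idx_sets)
    finally show ?thesis .
  qed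
  define E where "E = {z\<in>A. \<forall>k\<ge>k0. z \<notin> bad k}"
  have "E = A - (\<Union>k\<in>{k0..}. bad k)" by (auto simp: E_def)
  then have E [measurable]: "E \<in> sets lebesgue" by auto
  have "E \<subseteq> A" by (auto simp: E_def)
  have finE: "emeasure lebesgue E < \<infinity>"
    using emeasure_mono[OF \<open>E \<subseteq> A\<close>, of lebesgue] fin by (simp add: le_less_trans)
  have approx: "emeasure \<mu> E \<le> ennreal c * (emeasure lebesgue E + ennreal e)" if e: "e > 0" for e
  proof -
    obtain G where G: "open G" "E \<subseteq> G" "G - E \<in> lmeasurable" "emeasure lebesgue (G - E) < ennreal e"
      using sets_lebesgue_outer_open[OF E e] by blast
    \<comment> \<open>The stopping rule is containment in \<open>G\<close>. Every admissible cell of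
      a point of \<open>E\<close> has small mean, so minimality of the stopping generation is not
      involved in the mass bound.\<close>
    obtain U where "U \<in> sets lebesgue" "E \<subseteq> U" "emeasure \<mu> U \<le> ennreal c * emeasure lebesgue G"
    proof (rule stopping_cover[where P = "\<lambda>S. S \<subseteq> G" and ?k0.0 = k0])
      show "\<exists>k\<ge>k0. cell k z \<subseteq> G" if "z \<in> E" for z
        using idx_shrink[of G z k0] G that unfolding cell_def by blast
      show "emeasure \<mu> (cell k z) \<le> ennreal c * emeasure lebesgue (cell k z)"
        if "z \<in> E" "k0 \<le> k" for z k
        using that unfolding E_def bad_def by auto
      show "emeasure lebesgue (\<Union>S) \<le> emeasure lebesgue G"
        if "S \<subseteq> {cell k z | k z. k0 \<le> k \<and> z \<in> E \<and> cell k z \<subseteq> G}" for S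
        using that G(1) by (intro emeasure_mono) auto
    qed (rule s\<mu>)
    then have "emeasure \<mu> E \<le> ennreal c * emeasure lebesgue G"
      using emeasure_mono[of E U \<mu>] s\<mu> by auto
    also have "emeasure lebesgue G \<le> emeasure lebesgue E + ennreal e"
    proof -
      have "emeasure lebesgue G = emeasure lebesgue (E \<union> (G - E))"
        using G(2) by (simp add: Un_absorb1)
      also have "\<dots> \<le> emeasure lebesgue E + emeasure lebesgue (G - E)"
        using G(3) by (intro emeasure_subadditive) auto
      also have "\<dots> \<le> emeasure lebesgue E + ennreal e"
        using G(4) by (intro add_left_mono) auto
      finally show ?thesis .
    qed
    finally show ?thesis by (meson mult_left_mono order_trans zero_le)
  qed
  have le: "emeasure \<mu> E \<le> ennreal c * emeasure lebesgue E"
  proof -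
    obtain r where r: "emeasure lebesgue E = ennreal r" "0 \<le> r"
      using finE by (cases "emeasure lebesgue E") auto
    have le_e: "emeasure \<mu> E \<le> ennreal (c * r + c * e)" if "e > 0" for e
      using approx[OF that] that r \<open>0 \<le> c\<close>
      by (simp add: ennreal_mult'[symmetric] ennreal_plus[symmetric] distrib_left del: ennreal_plus)
    then have "emeasure \<mu> E \<le> ennreal (c * r) + ennreal e" if "e > 0" for e
    proof (cases "c = 0")
      case False
      then have "c > 0" using \<open>0 \<le> c\<close> by simp
      with that have "emeasure \<mu> E \<le> ennreal (c * r + c * (e / c))"
        by (intro le_e divide_pos_pos)
      then show ?thesis using \<open>c > 0\<close> r that by simp
    next
      case True
      then have "emeasure \<mu> E = 0"
        using le_e[OF that] by simp
      then show ?thesis by simp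
    qed
    then have "emeasure \<mu> E \<le> ennreal (c * r)"
      by (rule ennreal_le_epsilon)
    then show ?thesis unfolding r(1) ennreal_mult[OF \<open>0 \<le> c\<close> r(2)] .
  qed
  have "emeasure lebesgue E = 0"
  proof -
    have \<mu>E: "emeasure \<mu> E = (\<integral>\<^sup>+z. ennreal (f z) * indicator E z \<partial>lebesgue)"
      unfolding \<mu>_def by (rule emeasure_density) auto
    \<comment> \<open>The finite quantity \<open>c * emeasure lebesgue E\<close> is split off and
      cancelled, leaving a nonnegative integrand with integral 0.\<close>
    have "(\<integral>\<^sup>+z. ennreal (f z - c) * indicator E z \<partial>lebesgue) + ennreal c * emeasure lebesgue E
      = (\<integral>\<^sup>+z. ennreal (f z - c) * indicator E z + ennreal c * indicator E z \<partial>lebesgue)"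
      by (subst nn_integral_add) (auto simp: nn_integral_cmult_indicator)
    also have "\<dots> = emeasure \<mu> E"
      unfolding \<mu>E using f \<open>E \<subseteq> A\<close> \<open>0 \<le> c\<close>
      by (intro nn_integral_cong)
        (auto split: split_indicator simp: ennreal_plus[symmetric] less_imp_le simp del: ennreal_plus)
    finally have "(\<integral>\<^sup>+z. ennreal (f z - c) * indicator E z \<partial>lebesgue) + ennreal c * emeasure lebesgue E
      \<le> ennreal c * emeasure lebesgue E" using le by simp
    moreover have "ennreal c * emeasure lebesgue E < \<infinity>"
      using finE by (simp add: ennreal_mult_less_top)
    ultimately have "(\<integral>\<^sup>+z. ennreal (f z - c) * indicator E z \<partial>lebesgue) = 0"
      by (cases "\<integral>\<^sup>+z. ennreal (f z - c) * indicator E z \<partial>lebesgue";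
          cases "ennreal c * emeasure lebesgue E")
        (auto simp: ennreal_plus[symmetric] top_unique simp del: ennreal_plus)
    then have "AE z in lebesgue. ennreal (f z - c) * indicator E z = 0"
      by (subst (asm) nn_integral_0_iff_AE) auto
    then have "AE z in lebesgue. z \<notin> E"
    proof eventually_elim
      case (elim z)
      then show ?case using f \<open>E \<subseteq> A\<close> by (auto simp: ennreal_eq_0_iff) (meson f leD subsetD)
    qed
    then show ?thesis by (simp add: AE_iff_measurable[OF E])
  qed
  then have "AE z in lebesgue. z \<notin> E"
    by (intro AE_not_in) (auto simp: null_sets_def)
  then show ?thesis
    by eventually_elim (auto simp: E_def bad_def \<mu>_def)
qed

end

section \<open>The parabolic dyadic grid\<close>

lemma Times_in_borel:
  fixes A :: "'a::second_countable_topology set" and B :: "'b::second_countable_topology set"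
  assumes "A \<in> sets borel" "B \<in> sets borel"
  shows "A \<times> B \<in> sets borel"
  using assms by (metis borel_prod pair_measureI)

lemma emeasure_lebesgue_Times:
  fixes A :: "'a::euclidean_space set" and B :: "'b::euclidean_space set"
  assumes "A \<in> sets borel" "B \<in> sets borel"
  shows "emeasure lebesgue (A \<times> B) = emeasure lborel A * emeasure lborel B"
proof -
  have s: "A \<times> B \<in> sets lborel"
    using assms by (simp add: Times_in_borel)
  have "emeasure lebesgue (A \<times> B) = emeasure lborel (A \<times> B)"
    using s by (simp add: emeasure_completion)
  also have "\<dots> = emeasure (lborel \<Otimes>\<^sub>M lborel) (A \<times> B)"
    by (simp add: lborel_prod)
  also have "\<dots> = emeasure lborel A * emeasure lborel B"
    using assms by (intro lborel.emeasure_pair_measure_Times) auto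
  finally show ?thesis .
qed

lemma cube_eq_cbox: "cube x l = cbox (\<chi> i. x $ i - l / 2) (\<chi> i. x $ i + l / 2)"
proof -
  have "\<bar>u - v\<bar> \<le> l / 2 \<longleftrightarrow> v - l / 2 \<le> u \<and> u \<le> v + l / 2" for u v :: real by linarith
  then show ?thesis by (auto simp: cube_def mem_box_cart)
qed

lemma cube_borel [measurable]: "cube x l \<in> sets borel"
  by (simp add: cube_eq_cbox)

lemma inner_const_Basis:
  fixes b :: "real ^ 'n"
  assumes "b \<in> Basis"
  shows "(\<chi> i. l) \<bullet> b = l"
  using assms by (auto simp: Basis_vec_def inner_axis)

lemma emeasure_lborel_cbox_const:
  fixes c :: "real ^ 'n"
  assumes "0 \<le> l"
  shows "emeasure lborel (cbox c (c + (\<chi> i. l))) = ennreal (l ^ CARD('n))"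
    and "emeasure lborel (box c (c + (\<chi> i. l))) = ennreal (l ^ CARD('n))"
  using assms
  by (simp_all add: emeasure_lborel_cbox_eq emeasure_lborel_box_eq inner_add_left inner_const_Basis
      cong: prod.cong)

lemma emeasure_lborel_cube:
  fixes x :: "real ^ 'n"
  assumes "0 \<le> l"
  shows "emeasure lborel (cube x l) = ennreal (l ^ CARD('n))"
proof -
  have "(\<chi> i. x $ i + l / 2) = (\<chi> i. x $ i - l / 2) + (\<chi> i. l)"
    by (simp add: vec_eq_iff)
  then show ?thesis
    using emeasure_lborel_cbox_const(1)[OF assms] by (simp add: cube_eq_cbox)
qed

lemma emeasure_half_open_box:
  fixes c :: "'n::finite \<Rightarrow> real"
  assumes "0 \<le> l"
  shows "emeasure lborel {x :: real ^ 'n. \<forall>i. c i < x $ i \<and> x $ i \<le> c i + l} = ennreal (l ^ CARD('n))"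
    (is "emeasure lborel ?S = _")
    and "{x :: real ^ 'n. \<forall>i. c i < x $ i \<and> x $ i \<le> c i + l} \<in> sets borel"
proof -
  let ?c = "(\<chi> i. c i) :: real ^ 'n"
  have S: "?S = (\<Inter>i. {x. c i < x $ i} \<inter> {x. x $ i \<le> c i + l})" by auto
  show borel: "?S \<in> sets borel"
    unfolding S
    by (intro sets.finite_INT sets.Int borel_open borel_closed open_Collect_less closed_Collect_le
        continuous_intros) auto
  have "box ?c (?c + (\<chi> i. l)) \<subseteq> ?S" "?S \<subseteq> cbox ?c (?c + (\<chi> i. l))"
    by (auto simp: mem_box_cart less_imp_le)
  then have "emeasure lborel (box ?c (?c + (\<chi> i. l))) \<le> emeasure lborel ?S"
    "emeasure lborel ?S \<le> emeasure lborel (cbox ?c (?c + (\<chi> i. l)))"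
    using borel by (auto intro!: emeasure_mono)
  then show "emeasure lborel ?S = ennreal (l ^ CARD('n))"
    unfolding emeasure_lborel_cbox_const[OF assms] by simp
qed

lemma emeasure_cube_times_Ioo:
  fixes x :: "real ^ 'n"
  assumes "0 \<le> l" "a \<le> b"
  shows "emeasure lebesgue (cube x l \<times> {a<..<b}) = ennreal (l ^ CARD('n) * (b - a))"
  using assms by (simp add: emeasure_lebesgue_Times emeasure_lborel_cube ennreal_mult)

lemma emeasure_upper_part:
  fixes x :: "real ^ 'n"
  assumes "0 \<le> l"
  shows "emeasure lebesgue (upper_part p x t l) = ennreal (l ^ CARD('n) * l powr p)"
  using emeasure_cube_times_Ioo[OF assms, of t "t + l powr p" x] by (simp add: upper_part_def)

lemma emeasure_lower_part:
  fixes x :: "real ^ 'n"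
  assumes "0 \<le> l"
  shows "emeasure lebesgue (lower_part p x t l) = ennreal (l ^ CARD('n) * l powr p)"
  using emeasure_cube_times_Ioo[OF assms, of "t - l powr p" t x] by (simp add: lower_part_def)

lemma cube_times_sets [measurable]:
  fixes x :: "real ^ 'n"
  assumes "B \<in> sets borel"
  shows "cube x l \<times> (B :: real set) \<in> sets lebesgue"
  using assms by (intro sets_completionI_sets) (simp add: Times_in_borel)

lemma upper_part_sets [measurable]: "upper_part p x t l \<in> sets lebesgue"
  and lower_part_sets [measurable]: "lower_part p x t l \<in> sets lebesgue"
  by (simp_all add: upper_part_def lower_part_def cube_times_sets)

locale parabolic_grid =
  fixes p L t0 :: real and x0 :: "real ^ 'n"
  assumes p: "1 \<le> p" and L: "0 < L"
begin

definition T :: real where "T = L powr p"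
definition len :: "nat \<Rightarrow> real" where "len k = L / 2 ^ k"
definition rho :: "nat \<Rightarrow> real" where "rho k = len k powr p"

text \<open>The time axis is halved \<open>N k\<close> times, since \<open>2 powr p\<close> need not be an integer; the length
  \<open>h k\<close> of the resulting intervals is comparable to \<open>rho k\<close>.\<close>

definition N :: "nat \<Rightarrow> nat" where "N k = nat \<lceil>p * k\<rceil> + 1"
definition h :: "nat \<Rightarrow> real" where "h k = T / 2 ^ N k"
text \<open>Ceilings make the cells open at the left and closed at the right. The origin is the
  lowest corner of R, so that generation \<open>k\<close> subdivides the base cube exactly and
  starts at the bottom of R^-.\<close>

definition sidx :: "nat \<Rightarrow> (real ^ 'n) \<times> real \<Rightarrow> 'n \<Rightarrow> int" where
  "sidx k z a = \<lceil>(fst z $ a - (x0 $ a - L / 2)) / len k\<rceil>"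
definition tidx :: "nat \<Rightarrow> (real ^ 'n) \<times> real \<Rightarrow> int" where
  "tidx k z = \<lceil>(snd z - (t0 - T)) / h k\<rceil>"
definition idx :: "nat \<Rightarrow> (real ^ 'n) \<times> real \<Rightarrow> ('n \<Rightarrow> int) \<times> int" where
  "idx k z = (sidx k z, tidx k z)"
definition center :: "nat \<Rightarrow> (real ^ 'n) \<times> real \<Rightarrow> real ^ 'n" where
  "center k z = (\<chi> a. x0 $ a - L / 2 + (sidx k z a - 1 / 2) * len k)"

text \<open>The lower parabolic rectangle belonging to a cell is placed \<open>rho k / 2\<close> above the top of the
  half-open cell, so that it contains the cell.\<close>

definition tau :: "nat \<Rightarrow> (real ^ 'n) \<times> real \<Rightarrow> real" where
  "tau k z = t0 - T + tidx k z * h k + rho k / 2"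

lemma T_pos: "0 < T" using L by (simp add: T_def)
lemma len_pos: "0 < len k" using L by (simp add: len_def)
lemma rho_pos: "0 < rho k" using len_pos[of k] by (simp add: rho_def)
lemma h_pos: "0 < h k" using T_pos by (simp add: h_def)

lemma rho_eq: "rho k = T * 2 powr (- (p * k))"
proof -
  have "len k = L * 2 powr (- real k)"
    by (simp add: len_def powr_minus powr_realpow divide_inverse)
  then have "rho k = L powr p * (2 powr (- real k)) powr p"
    using L by (simp add: rho_def powr_mult)
  then show ?thesis by (simp add: powr_powr T_def mult.commute)
qed

lemma N_bounds: "p * k + 1 \<le> N k" "N k < p * k + 2"
proof -
  have "0 \<le> p * k" using p by simp
  then have "real (N k) = of_int \<lceil>p * k\<rceil> + 1" by (simp add: N_def of_nat_nat)
  then show "p * k + 1 \<le> N k" "N k < p * k + 2" by linarith+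
qed

lemma h_eq: "h k = T * 2 powr (- real (N k))"
  by (simp add: h_def powr_minus powr_realpow divide_inverse)

text \<open>The additional halving in \<open>N\<close> produces the 1/2. It leaves the room of
  \<open>rho k / 2\<close> above a cell that \<open>tau\<close> uses; \<open>h_ge\<close> bounds the
  loss in passing from a cell to its lower rectangle by the factor 4.\<close>

lemma h_le: "h k \<le> rho k / 2"
proof -
  have "2 powr (- real (N k)) \<le> 2 powr (- (p * k) - 1)"
    using N_bounds[of k] by (intro powr_mono) auto
  also have "\<dots> = 2 powr (- (p * k)) / 2" by (simp add: powr_diff)
  finally show ?thesis using T_pos by (simp add: h_eq rho_eq)
qed

lemma h_ge: "rho k \<le> 4 * h k"
proof -
  have "2 powr (- (p * k)) / 4 = 2 powr (- (p * k) - 2)" by (simp add: powr_diff)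
  also have "\<dots> \<le> 2 powr (- real (N k))"
    using N_bounds[of k] by (intro powr_mono) auto
  finally show ?thesis using T_pos by (simp add: h_eq rho_eq)
qed

lemma rho_le: "rho k \<le> T / 2 ^ k"
proof -
  have "2 powr (- (p * k)) \<le> 2 powr (- real k)"
    using p mult_right_mono[of 1 p "real k"] by (intro powr_mono) auto
  then show ?thesis using T_pos by (simp add: rho_eq powr_minus powr_realpow divide_inverse)
qed

lemma rho_antimono: "k \<le> k' \<Longrightarrow> rho k' \<le> rho k"
  using p T_pos mult_left_mono[of "real k" "real k'" p] by (simp add: rho_eq)

lemma len_antimono: "k \<le> k' \<Longrightarrow> len k' \<le> len k"
  using L by (simp add: len_def frac_le)

text \<open>The first part makes the time intervals nested; the second one bounds the number of
  pieces per generation and is the source of the \<open>nat \<lceil>p\<rceil>\<close> in the volume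
  ratio.\<close>

lemma N_Suc: "N k \<le> N (Suc k)" "N (Suc k) \<le> N k + nat \<lceil>p\<rceil>"
proof -
  have *: "p * real (Suc k) = p * real k + p" by (simp add: algebra_simps)
  have 0: "0 \<le> p * k" using p by simp
  show "N k \<le> N (Suc k)"
    unfolding N_def * using p by (intro add_right_mono nat_mono ceiling_mono) auto
  have "\<lceil>p * real k + p\<rceil> \<le> \<lceil>p * real k\<rceil> + \<lceil>p\<rceil>" by (rule ceiling_add_le)
  then show "N (Suc k) \<le> N k + nat \<lceil>p\<rceil>"
    unfolding N_def * using p 0 by linarith
qed

lemma same_sidx:
  "sidx k y a = sidx k z a \<longleftrightarrow>
    x0 $ a - L / 2 + (sidx k z a - 1) * len k < fst y $ a \<and>
    fst y $ a \<le> x0 $ a - L / 2 + sidx k z a * len k"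
  unfolding sidx_def[of k y] ceiling_eq_iff using len_pos[of k]
  by (simp add: field_simps)

lemma same_tidx:
  "tidx k y = tidx k z \<longleftrightarrow>
    t0 - T + (tidx k z - 1) * h k < snd y \<and> snd y \<le> t0 - T + tidx k z * h k"
  unfolding tidx_def[of k y] ceiling_eq_iff using h_pos[of k]
  by (simp add: field_simps)

lemma idx_cell_eq:
  "{y. idx k y = idx k z} =
    {x. \<forall>a. x0 $ a - L / 2 + (sidx k z a - 1) * len k < x $ a \<and>
      x $ a \<le> (x0 $ a - L / 2 + (sidx k z a - 1) * len k) + len k} \<times>
    {t0 - T + (tidx k z - 1) * h k <.. t0 - T + tidx k z * h k}"
proof -
  have "x0 $ a - L / 2 + of_int (sidx k z a - 1) * len k + len k = x0 $ a - L / 2 + sidx k z a * len k" for a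
    by (simp add: algebra_simps)
  then show ?thesis 
    by (simp only: idx_def prod.inject fun_eq_iff same_sidx same_tidx set_eq_iff mem_Times_iff
        mem_Collect_eq greaterThanAtMost_iff) blast
qed

lemma idx_cell_sets: "{y. idx k y = v} \<in> sets lebesgue"
proof (cases "\<exists>z. v = idx k z")
  case True
  then obtain z where "v = idx k z" by blast
  show ?thesis
    unfolding \<open>v = idx k z\<close> idx_cell_eq using emeasure_half_open_box(2)
    by (intro sets_completionI_sets) (auto intro!: Times_in_borel simp: less_imp_le[OF len_pos])
next
  case False
  then have empty: "{y. idx k y = v} = {}" by blast
  show ?thesis unfolding empty by simp
qed

lemma idx_dist:
  assumes "idx k y = idx k z"
  shows "\<bar>fst y $ a - fst z $ a\<bar> < len k" "\<bar>snd y - snd z\<bar> < h k"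
proof -
  have "sidx k y a = sidx k z a" "sidx k z a = sidx k z a" "tidx k y = tidx k z" "tidx k z = tidx k z"
    using assms by (auto simp: idx_def)
  from this(1)[unfolded same_sidx] this(2)[unfolded same_sidx] this(3)[unfolded same_tidx]
    this(4)[unfolded same_tidx]
  show "\<bar>fst y $ a - fst z $ a\<bar> < len k" "\<bar>snd y - snd z\<bar> < h k"
    by (auto simp: algebra_simps abs_less_iff)
qed

sublocale filtration idx
proof
  show "idx k y = idx k z" if "idx (Suc k) y = idx (Suc k) z" for k y z
  proof -
    \<comment> \<open>Each coordinate is refined by an integer factor, 2 in space and a power of 2
      in time, so that \<open>ceiling_eq_coarser\<close> applies.\<close>
    have s: "u / len (Suc k) = u / len k * real 2" for u
      by (simp add: len_def)
    have "h k = h (Suc k) * real (2 ^ (N (Suc k) - N k))"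
      using N_Suc(1)[of k] by (simp add: h_def field_simps power_add[symmetric])
    then have t: "u / h (Suc k) = u / h k * real (2 ^ (N (Suc k) - N k))" for u
      using h_pos[of k] h_pos[of "Suc k"] by (simp add: field_simps)
    have "sidx k y a = sidx k z a" for a
    proof -
      have "sidx (Suc k) y a = sidx (Suc k) z a" using that by (simp add: idx_def)
      then show ?thesis unfolding sidx_def s by (rule ceiling_eq_coarser[rotated]) simp
    qed
    moreover have "tidx k y = tidx k z"
    proof -
      have "tidx (Suc k) y = tidx (Suc k) z" using that by (simp add: idx_def)
      then show ?thesis unfolding tidx_def t by (rule ceiling_eq_coarser[rotated]) simp
    qed
    ultimately show ?thesis by (simp add: idx_def fun_eq_iff)
  qed
next
  fix k v show "{y. idx k y = v} \<in> sets lebesgue" by (rule idx_cell_sets)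
next
  fix G :: "((real ^ 'n) \<times> real) set" and z k0
  assume "open G" "z \<in> G"
  then obtain e where e: "e > 0" "ball z e \<subseteq> G" by (meson open_contains_ball)
  define B where "B = CARD('n) * L + T"
  have B: "B > 0" using L T_pos by (simp add: B_def add_nonneg_pos)
  obtain k1 :: nat where k1: "B / e < 2 ^ k1" using real_arch_pow[of 2 "B / e"] by auto
  define k where "k = max k0 k1"
  have "B / e < 2 ^ k" using k1 by (rule less_le_trans) (simp add: k_def power_increasing)
  then have small: "B / 2 ^ k < e" using e(1) by (simp add: field_simps)
  have "{y. idx k y = idx k z} \<subseteq> ball z e"
  proof
    fix y assume "y \<in> {y. idx k y = idx k z}"
    then have d: "\<bar>fst y $ a - fst z $ a\<bar> < len k" "\<bar>snd y - snd z\<bar> < h k" for a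
      using idx_dist by auto
    have "norm (fst y - fst z) \<le> (\<Sum>a\<in>UNIV. \<bar>(fst y - fst z) $ a\<bar>)" by (rule norm_le_l1_cart)
    also have "\<dots> \<le> (\<Sum>a\<in>(UNIV::'n set). len k)" using d(1) by (intro sum_mono) (auto simp: less_imp_le)
    finally have 1: "norm (fst y - fst z) \<le> CARD('n) * len k" by simp
    have "norm (snd y - snd z) < T / 2 ^ k"
      using d(2) h_le[of k] rho_pos[of k] rho_le[of k] by simp
    moreover have "norm (y - z) \<le> norm (fst y - fst z) + norm (snd y - snd z)"
      using norm_Pair_le[of "fst y - fst z" "snd y - snd z"] by (simp flip: minus_prod_def fst_diff snd_diff)
    moreover have "CARD('n) * len k + T / 2 ^ k = B / 2 ^ k"
      by (simp add: B_def len_def add_divide_distrib)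
    ultimately have "norm (y - z) < e" using 1 small by linarith
    then show "y \<in> ball z e" by (simp add: dist_norm norm_minus_commute)
  qed
  then show "\<exists>k\<ge>k0. {y. idx k y = idx k z} \<subseteq> G"
    using e(2) by (intro exI[of _ k]) (auto simp: k_def)
qed

lemma emeasure_cell: "emeasure lebesgue (cell k z) = ennreal (len k ^ CARD('n) * h k)"
proof -
  have "t0 - T + (tidx k z - 1) * h k \<le> t0 - T + tidx k z * h k"
    using h_pos[of k] by (simp add: algebra_simps)
  then have "emeasure lborel {t0 - T + (tidx k z - 1) * h k <.. t0 - T + tidx k z * h k} = ennreal (h k)"
    by (simp add: algebra_simps)
  then show ?thesis
    unfolding cell_def idx_cell_eq
    using len_pos[of k] h_pos[of k]
    by (subst emeasure_lebesgue_Times) (auto simp: emeasure_half_open_box ennreal_mult)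
qed

lemma center_nth: "center k z $ a = x0 $ a - L / 2 + sidx k z a * len k - len k / 2"
  by (simp add: center_def left_diff_distrib)

lemma cell_subset_lower_part: "cell k z \<subseteq> lower_part p (center k z) (tau k z) (len k)"
proof
  fix y assume "y \<in> cell k z"
  then have y: "sidx k y a = sidx k z a" "tidx k y = tidx k z" for a
    by (auto simp: cell_def idx_def)
  have "\<bar>fst y $ a - center k z $ a\<bar> \<le> len k / 2" for a
  proof -
    have "x0 $ a - L / 2 + (sidx k z a * len k - len k) < fst y $ a"
      "fst y $ a \<le> x0 $ a - L / 2 + sidx k z a * len k"
      using y(1)[of a, unfolded same_sidx] by (auto simp: left_diff_distrib)
    then show ?thesis unfolding center_nth by linarith
  qed
  moreover have "tau k z - rho k < snd y" "snd y < tau k z"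
    using y(2)[unfolded same_tidx] h_le[of k] rho_pos[of k] by (auto simp: tau_def left_diff_distrib)
  ultimately show "y \<in> lower_part p (center k z) (tau k z) (len k)"
    by (auto simp: lower_part_def cube_def mem_Times_iff rho_def)
qed

lemma tau_bounds: "snd z < tau k z" "tau k z \<le> snd z + rho k"
  and cell_time: "y \<in> cell k z \<Longrightarrow> snd y < tau k z"
proof -
  have "t0 - T + (tidx k z - 1) * h k < snd z" "snd z \<le> t0 - T + tidx k z * h k"
    using same_tidx[of k z z] by auto
  then show "snd z < tau k z" "tau k z \<le> snd z + rho k"
    using h_le[of k] rho_pos[of k] by (auto simp: tau_def algebra_simps)
  show "snd y < tau k z" if "y \<in> cell k z"
    using that rho_pos[of k] by (auto simp: cell_def idx_def same_tidx tau_def)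
qed

text \<open>Half-open like the cells, so that a cell meeting the slab is contained in it.\<close>

definition slab :: "((real ^ 'n) \<times> real) set" where
  "slab = {z. (\<forall>a. x0 $ a - L / 2 < fst z $ a \<and> fst z $ a \<le> x0 $ a + L / 2) \<and> t0 - T < snd z}"

text \<open>Since \<open>len k * 2 ^ k = L\<close>, a point of the slab has spatial labels between 1
  and \<open>2 ^ k\<close>. So the closed cube of its cell, and with it the upper rectangle, stays
  over the base cube; in time there is only the barrier from below.\<close>

lemma cell_in_slab:
  assumes "z \<in> slab"
  shows "cube (center k z) (len k) \<subseteq> cube x0 L" "y \<in> cell k z \<Longrightarrow> t0 - T < snd y"
proof -
  have s: "1 \<le> sidx k z a \<and> sidx k z a \<le> 2 ^ k" for a
  proof -
    have "0 < (fst z $ a - (x0 $ a - L / 2)) / len k"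
      using assms len_pos[of k] by (simp add: slab_def)
    then have "0 < sidx k z a" unfolding sidx_def less_ceiling_iff by simp
    moreover have "fst z $ a - (x0 $ a - L / 2) \<le> 2 ^ k * len k"
      using assms by (simp add: slab_def len_def) (smt (verit) field_sum_of_halves)
    then have "(fst z $ a - (x0 $ a - L / 2)) / len k \<le> 2 ^ k"
      using len_pos[of k] by (simp add: pos_divide_le_eq)
    then have "sidx k z a \<le> 2 ^ k" unfolding sidx_def ceiling_le_iff by simp
    ultimately show ?thesis by simp
  qed
  have "\<bar>y $ a - x0 $ a\<bar> \<le> L / 2" if "\<bar>y $ a - center k z $ a\<bar> \<le> len k / 2" for y a
  proof -
    have "1 * len k \<le> of_int (sidx k z a) * len k" "of_int (sidx k z a) * len k \<le> 2 ^ k * len k"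
    proof -
      have "1 \<le> real_of_int (sidx k z a)" "real_of_int (sidx k z a) \<le> 2 ^ k"
        using s[of a] of_int_le_iff[of "sidx k z a" "2 ^ k", where 'a = real] by auto
      then show "1 * len k \<le> of_int (sidx k z a) * len k" "of_int (sidx k z a) * len k \<le> 2 ^ k * len k"
        using len_pos[of k] by (auto intro: mult_right_mono)
    qed
    moreover have "2 ^ k * len k = L" by (simp add: len_def)
    ultimately show ?thesis
      using that unfolding center_nth by linarith
  qed
  then show "cube (center k z) (len k) \<subseteq> cube x0 L" by (auto simp: cube_def)
  have "0 < (snd z - (t0 - T)) / h k" using assms h_pos[of k] by (simp add: slab_def)
  then have "1 \<le> tidx k z" unfolding tidx_def by (smt (verit) less_ceiling_iff of_int_0)
  then have "0 \<le> (of_int (tidx k z) - 1) * h k" using h_pos[of k] by simp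
  then show "t0 - T < snd y" if "y \<in> cell k z"
    using that by (auto simp: cell_def idx_def same_tidx)
qed

text \<open>Only the left faces of the closed cube are lost, and they lie in finitely many null
  hyperplanes.\<close>

lemma AE_slab: "AE z in lebesgue. z \<in> cube x0 L \<times> {t0 - T<..} \<longrightarrow> z \<in> slab"
proof -
  have null: "AE z :: (real ^ 'n) \<times> real in lebesgue. fst z $ a \<noteq> x0 $ a - L / 2" for a
  proof -
    have "(axis a 1 :: real ^ 'n, 0 :: real) \<in> Basis"
      by (auto simp: Basis_prod_def Basis_vec_def)
    then have "negligible {z :: (real ^ 'n) \<times> real. z \<bullet> (axis a 1, 0) = x0 $ a - L / 2}"
      by (rule negligible_standard_hyperplane)
    then have "{z :: (real ^ 'n) \<times> real. fst z $ a = x0 $ a - L / 2} \<in> null_sets lebesgue"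
      by (simp add: negligible_iff_null_sets inner_prod_def inner_axis)
    then show ?thesis by (rule AE_I') auto
  qed
  have "AE z :: (real ^ 'n) \<times> real in lebesgue. \<forall>a. fst z $ a \<noteq> x0 $ a - L / 2"
    using null by (simp add: AE_all_countable)
  then show ?thesis
  proof eventually_elim
    case (elim z)
    show ?case
    proof
      assume z: "z \<in> cube x0 L \<times> {t0 - T<..}"
      have "x0 $ a - L / 2 < fst z $ a \<and> fst z $ a \<le> x0 $ a + L / 2" for a
      proof -
        have "\<bar>fst z $ a - x0 $ a\<bar> \<le> L / 2" using z by (auto simp: cube_def)
        moreover have "fst z $ a \<noteq> x0 $ a - L / 2" using elim by blast
        ultimately show ?thesis by linarith
      qed
      then show "z \<in> slab" using z by (auto simp: slab_def)
    qed
  qed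
qed

lemma emeasure_cell_Suc:
  "emeasure lebesgue (cell k z) \<le> ennreal (2 ^ (CARD('n) + nat \<lceil>p\<rceil>)) * emeasure lebesgue (cell (Suc k) y)"
proof -
  have "len k = 2 * len (Suc k)" by (simp add: len_def)
  moreover have "h k \<le> 2 ^ nat \<lceil>p\<rceil> * h (Suc k)"
  proof -
    have "(2::real) ^ N (Suc k) \<le> 2 ^ (N k + nat \<lceil>p\<rceil>)"
      using N_Suc(2)[of k] by (intro power_increasing) auto
    then show ?thesis using T_pos by (simp add: h_def field_simps power_add)
  qed
  ultimately have "len k ^ CARD('n) * h k
      \<le> 2 ^ (CARD('n) + nat \<lceil>p\<rceil>) * (len (Suc k) ^ CARD('n) * h (Suc k))"
    using len_pos[of "Suc k"] mult_left_mono[of "h k" "2 ^ nat \<lceil>p\<rceil> * h (Suc k)" "2 ^ CARD('n) * len (Suc k) ^ CARD('n)"]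
    by (simp add: power_mult_distrib power_add mult_ac)
  then have "ennreal (len k ^ CARD('n) * h k)
      \<le> ennreal (2 ^ (CARD('n) + nat \<lceil>p\<rceil>) * (len (Suc k) ^ CARD('n) * h (Suc k)))"
    by (rule ennreal_leI)
  then show ?thesis
    using len_pos[of "Suc k"] h_pos[of "Suc k"] by (simp add: emeasure_cell ennreal_mult)
qed

lemma emeasure_cell_add:
  "emeasure lebesgue (cell k z) \<le> ennreal ((2 ^ (CARD('n) + nat \<lceil>p\<rceil>)) ^ j) * emeasure lebesgue (cell (k + j) z)"
proof (induction j)
  case (Suc j)
  have "emeasure lebesgue (cell k z)
    \<le> ennreal ((2 ^ (CARD('n) + nat \<lceil>p\<rceil>)) ^ j) * (ennreal (2 ^ (CARD('n) + nat \<lceil>p\<rceil>)) * emeasure lebesgue (cell (Suc (k + j)) z))"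
    by (rule order_trans[OF Suc.IH mult_left_mono[OF emeasure_cell_Suc]]) simp
  also have "\<dots> = ennreal ((2 ^ (CARD('n) + nat \<lceil>p\<rceil>)) ^ Suc j) * emeasure lebesgue (cell (k + Suc j) z)"
    by (simp only: power_Suc mult.assoc[symmetric] ennreal_mult[symmetric] zero_le_power zero_le_numeral add_Suc_right)
      (simp add: mult.commute)
  finally show ?case .
qed simp

text \<open>Indexed by generation and a representative point, not by the cell as a set, so that the
  generation, on which the selection is based, can be read off. All points of one cell give the same
  rectangle.\<close>

definition star :: "nat \<times> ((real ^ 'n) \<times> real) \<Rightarrow> ((real ^ 'n) \<times> real) set" where
  "star i = upper_part p (center (fst i) (snd i)) (tau (fst i) (snd i)) (len (fst i))"

lemma emeasure_star: "emeasure lebesgue (star i) = ennreal (len (fst i) ^ CARD('n) * rho (fst i))"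
  using len_pos by (simp add: star_def emeasure_upper_part rho_def less_imp_le)

lemma star_sets [measurable]: "star i \<in> sets lebesgue"
  by (simp add: star_def)

lemma star_nonempty: "star i \<noteq> {}"
proof
  assume "star i = {}"
  then have "ennreal (len (fst i) ^ CARD('n) * rho (fst i)) = 0" using emeasure_star[of i] by simp
  moreover have "0 < len (fst i) ^ CARD('n) * rho (fst i)" by (simp add: len_pos rho_pos)
  ultimately show False by (simp add: ennreal_eq_0_iff)
qed

text \<open>A cell whose upper rectangle meets that of a larger cell lies in the threefold enlargement of
  the latter.\<close>

lemma vitali_cells:
  assumes "finite I"
  shows "\<exists>J\<subseteq>I. disjoint_family_on star J \<and>
    emeasure lebesgue (\<Union>i\<in>I. cell (fst i) (snd i))
      \<le> ennreal (3 ^ (CARD('n) + 1)) * (\<Sum>j\<in>J. emeasure lebesgue (star j))"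
proof -
  obtain J where J: "J \<subseteq> I" "disjoint_family_on star J"
    "\<And>i. i \<in> I \<Longrightarrow> \<exists>j\<in>J. fst j \<le> fst i \<and> star i \<inter> star j \<noteq> {}"
    using finite_disjoint_subfamily[OF assms, of star fst] star_nonempty by metis
  \<comment> \<open>The time interval is asymmetric: from a common point of the two upper rectangles
    a point of the smaller lower rectangle is reached by going back less than
    \<open>2 * rho\<close>, and never forward. The height \<open>3 * rho\<close> contributes the
    last factor in \<open>3 ^ (CARD('n) + 1)\<close>.\<close>
  define big where "big j = cube (center (fst j) (snd j)) (3 * len (fst j)) \<times>
    {tau (fst j) (snd j) - 2 * rho (fst j) <..< tau (fst j) (snd j) + rho (fst j)}" for j
  have sub: "cell (fst i) (snd i) \<subseteq> big j"
    if ij: "fst j \<le> fst i" "star i \<inter> star j \<noteq> {}" for i j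
  proof
    fix y assume "y \<in> cell (fst i) (snd i)"
    then have y: "y \<in> lower_part p (center (fst i) (snd i)) (tau (fst i) (snd i)) (len (fst i))"
      using cell_subset_lower_part by blast
    obtain u where u: "u \<in> star i" "u \<in> star j" using ij(2) by auto
    have len: "len (fst i) \<le> len (fst j)" and rho: "rho (fst i) \<le> rho (fst j)"
      using ij(1) len_antimono rho_antimono by auto
    have "\<bar>fst y $ a - center (fst j) (snd j) $ a\<bar> \<le> 3 * len (fst j) / 2" for a
    proof -
      have "\<bar>fst y $ a - center (fst i) (snd i) $ a\<bar> \<le> len (fst i) / 2"
        "\<bar>fst u $ a - center (fst i) (snd i) $ a\<bar> \<le> len (fst i) / 2"
        "\<bar>fst u $ a - center (fst j) (snd j) $ a\<bar> \<le> len (fst j) / 2"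
        using y u by (auto simp: lower_part_def star_def upper_part_def cube_def)
      then show ?thesis using len by linarith
    qed
    moreover have "tau (fst j) (snd j) - 2 * rho (fst j) < snd y"
      "snd y < tau (fst j) (snd j) + rho (fst j)"
      using y u rho by (auto simp: lower_part_def star_def upper_part_def rho_def)
    ultimately show "y \<in> big j" by (auto simp: big_def cube_def mem_Times_iff)
  qed
  have big: "emeasure lebesgue (big j) = ennreal (3 ^ (CARD('n) + 1)) * emeasure lebesgue (star j)" for j
  proof -
    have "emeasure lebesgue (big j) = ennreal ((3 * len (fst j)) ^ CARD('n) * (3 * rho (fst j)))"
      unfolding big_def using len_pos[of "fst j"] rho_pos[of "fst j"]
      by (subst emeasure_cube_times_Ioo) (auto simp: algebra_simps)
    also have "\<dots> = ennreal (3 ^ (CARD('n) + 1) * (len (fst j) ^ CARD('n) * rho (fst j)))"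
      by (simp add: power_mult_distrib mult_ac)
    also have "\<dots> = ennreal (3 ^ (CARD('n) + 1)) * emeasure lebesgue (star j)"
      unfolding emeasure_star using len_pos[of "fst j"] rho_pos[of "fst j"] by (intro ennreal_mult) auto
    finally show ?thesis .
  qed
  have big_sets: "big j \<in> sets lebesgue" for j
    unfolding big_def by (rule cube_times_sets) simp
  have fJ: "finite J" using J(1) assms finite_subset by blast
  have "emeasure lebesgue (\<Union>i\<in>I. cell (fst i) (snd i)) \<le> emeasure lebesgue (\<Union>j\<in>J. big j)"
  proof (rule emeasure_mono)
    show "(\<Union>i\<in>I. cell (fst i) (snd i)) \<subseteq> (\<Union>j\<in>J. big j)"
    proof (rule UN_least)
      fix i assume "i \<in> I"
      with J(3) obtain j where "j \<in> J" "fst j \<le> fst i" "star i \<inter> star j \<noteq> {}" by blast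
      then show "cell (fst i) (snd i) \<subseteq> (\<Union>j\<in>J. big j)" using sub[of j i] by blast
    qed
    show "(\<Union>j\<in>J. big j) \<in> sets lebesgue"
      using fJ by (intro sets.finite_UN big_sets)
  qed
  also have "\<dots> \<le> (\<Sum>j\<in>J. emeasure lebesgue (big j))"
    using fJ by (intro emeasure_subadditive_finite image_subsetI big_sets)
  also have "\<dots> = ennreal (3 ^ (CARD('n) + 1)) * (\<Sum>j\<in>J. emeasure lebesgue (star j))"
    by (simp add: big sum_distrib_left)
  finally show ?thesis using J by blast
qed

end

section \<open>The level set estimate\<close>

text \<open>The hypothesis in real terms: \<open>a\<close> is the mean of \<open>w\<close> over the
  upper part. Its existence includes that the masses of \<open>w\<close> above and of w^q below are
  finite.\<close>

locale reverse_hoelder = parabolic_grid p L t0 x0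
  for p L t0 :: real and x0 :: "real ^ 'n" +
  fixes w :: "(real ^ 'n) \<times> real \<Rightarrow> real" and q C1 :: real
  assumes q: "1 < q" and C1: "0 < C1"
    and w_nonneg: "0 \<le> w z" and w_meas [measurable]: "w \<in> borel_measurable lebesgue"
    and RH: "0 < l \<Longrightarrow> \<exists>a\<ge>0.
      emeasure (density lebesgue (\<lambda>z. ennreal (w z))) (upper_part p x t l)
        = ennreal (a * (l ^ CARD('n) * l powr p)) \<and>
      emeasure (density lebesgue (\<lambda>z. ennreal (w z powr q))) (lower_part p x t l)
        \<le> ennreal ((C1 * a) powr q * (l ^ CARD('n) * l powr p))"
begin

definition mu where "mu = density lebesgue (\<lambda>z. ennreal (w z powr q))"
definition nu where "nu = density lebesgue (\<lambda>z. ennreal (w z))"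

lemma sets_mu: "sets mu = sets lebesgue" and sets_nu: "sets nu = sets lebesgue"
  by (simp_all add: mu_def nu_def)

lemma cell_reverse_hoelder:
  obtains a where "0 \<le> a"
    "emeasure nu (star (k, z)) = ennreal (a * (len k ^ CARD('n) * rho k))"
    "emeasure mu (cell k z) \<le> ennreal (4 * (C1 * a) powr q) * emeasure lebesgue (cell k z)"
proof -
  obtain a where a: "0 \<le> a" "emeasure nu (star (k, z)) = ennreal (a * (len k ^ CARD('n) * rho k))"
    "emeasure mu (lower_part p (center k z) (tau k z) (len k))
      \<le> ennreal ((C1 * a) powr q * (len k ^ CARD('n) * rho k))"
    using RH[OF len_pos[of k], of "center k z" "tau k z"]
    unfolding star_def mu_def nu_def rho_def by auto
  have "emeasure mu (cell k z) \<le> emeasure mu (lower_part p (center k z) (tau k z) (len k))"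
    using cell_subset_lower_part by (intro emeasure_mono) (auto simp: sets_mu)
  also note a(3)
  also have "ennreal ((C1 * a) powr q * (len k ^ CARD('n) * rho k))
      \<le> ennreal ((C1 * a) powr q * (4 * (len k ^ CARD('n) * h k)))"
    using h_ge[of k] len_pos[of k] mult_left_mono[of "rho k" "4 * h k" "len k ^ CARD('n)"]
    by (intro ennreal_leI mult_left_mono) (auto simp: mult_ac)
  also have "\<dots> = ennreal (4 * (C1 * a) powr q) * emeasure lebesgue (cell k z)"
    using len_pos[of k] h_pos[of k] by (simp add: emeasure_cell mult_ac flip: ennreal_mult)
  finally show thesis using that a(1,2) by blast
qed

text \<open>R^- is handled by the hypothesis for R. The strip \<open>W\<close> above it is covered
  by cells of the fixed generation \<open>k0\<close>; their upper rectangles lie in R^+, so the mean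
  of \<open>w\<close> there exceeds \<open>\<alpha>\<close> at most by the volume ratio
  \<open>M0\<close>. The 8 is the 4 of \<open>cell_reverse_hoelder\<close> times the 2 from the
  volume of all of R.\<close>

lemma initial_mass:
  assumes k0: "2 \<le> k0" and alpha: "0 \<le> \<alpha>"
    "emeasure nu (upper_part p x0 t0 L) = ennreal (\<alpha> * (L ^ CARD('n) * T))"
  shows "emeasure mu (cube x0 L \<times> {t0 - T <..< t0 + T / 2})
    \<le> ennreal ((1 + 8 * ((2 ^ k0) ^ CARD('n) * 2 powr (p * k0)) powr q) * (C1 * \<alpha>) powr q * (L ^ CARD('n) * T))"
proof -
  let ?R = "L ^ CARD('n) * T"
  define M0 where "M0 = (2 ^ k0) ^ CARD('n) * 2 powr (p * k0)"
  have M0: "0 < M0" by (simp add: M0_def)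
  have R: "0 < ?R" using L T_pos by simp
  \<comment> \<open>An upper rectangle over a point before \<open>t0 + T / 2\<close> ends by
    \<open>2 * rho k0\<close> later at most, thus before \<open>t0 + T\<close>.\<close>
  have rho: "4 * rho k \<le> T" if "k0 \<le> k" for k
  proof -
    have "(2::real) ^ 2 \<le> 2 ^ k" using k0 that by (intro power_increasing) auto
    then have "T / 2 ^ k \<le> T / 4" using T_pos by (intro divide_left_mono) auto
    then show ?thesis using rho_le[of k] by linarith
  qed
  define W where "W = cube x0 L \<times> {t0..<t0 + T / 2}"
  have W_sets: "W \<in> sets lebesgue" unfolding W_def by (rule cube_times_sets) simp
  have star_mass: "emeasure mu (cell k0 z) \<le> ennreal (4 * (C1 * (M0 * \<alpha>)) powr q) * emeasure lebesgue (cell k0 z)"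
    if z: "z \<in> W" "z \<in> slab" for z
  proof -
    let ?s = "len k0 ^ CARD('n) * rho k0"
    have s: "0 < ?s" using len_pos rho_pos by simp
    obtain a where a: "0 \<le> a" "emeasure nu (star (k0, z)) = ennreal (a * ?s)"
      "emeasure mu (cell k0 z) \<le> ennreal (4 * (C1 * a) powr q) * emeasure lebesgue (cell k0 z)"
      by (rule cell_reverse_hoelder)
    have "star (k0, z) \<subseteq> upper_part p x0 t0 L"
    proof
      fix y assume y: "y \<in> star (k0, z)"
      then have "fst y \<in> cube x0 L" "tau k0 z < snd y" "snd y < tau k0 z + rho k0"
        using cell_in_slab(1)[OF z(2), of k0] by (auto simp: star_def upper_part_def rho_def)
      moreover have "t0 \<le> snd z" "snd z < t0 + T / 2" using z(1) by (auto simp: W_def)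
      ultimately show "y \<in> upper_part p x0 t0 L"
        using tau_bounds[where z = z and k = k0] rho[of k0] by (auto simp: upper_part_def mem_Times_iff T_def)
    qed
    then have "emeasure nu (star (k0, z)) \<le> emeasure nu (upper_part p x0 t0 L)"
      by (intro emeasure_mono) (auto simp: sets_nu)
    then have "a * ?s \<le> \<alpha> * ?R" unfolding a(2) alpha(2) using alpha(1) R by (subst (asm) ennreal_le_iff) auto
    moreover have "?R = M0 * ?s"
    proof -
      have "2 powr (p * k0) * 2 powr (- (p * k0)) = (1::real)" by (simp flip: powr_add)
      then show ?thesis
        unfolding M0_def rho_eq len_def by (simp add: power_divide mult_ac)
    qed
    ultimately have "a * ?s \<le> (M0 * \<alpha>) * ?s" by (simp only: mult_ac)
    then have "a \<le> M0 * \<alpha>" using s mult_le_cancel_right_pos by blast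
    then have "(C1 * a) powr q \<le> (C1 * (M0 * \<alpha>)) powr q"
      using C1 a(1) q by (intro powr_mono2 mult_left_mono) auto
    then show ?thesis
      by (intro order_trans[OF a(3)] mult_right_mono ennreal_leI) auto
  qed
  \<comment> \<open>With a trivial stopping rule every point stops at once, and the cover is
    generation \<open>k0\<close> of the grid.\<close>
  obtain U where U: "U \<in> sets lebesgue" "W \<inter> slab \<subseteq> U"
    "emeasure mu U \<le> ennreal (4 * (C1 * (M0 * \<alpha>)) powr q) * ennreal (2 * ?R)"
  proof (rule stopping_cover[where P = "\<lambda>_. True" and ?k0.0 = k0 and E = "W \<inter> slab"])
    show "emeasure mu (cell k z) \<le> ennreal (4 * (C1 * (M0 * \<alpha>)) powr q) * emeasure lebesgue (cell k z)"
      if "z \<in> W \<inter> slab" "k0 \<le> k" "\<And>i. k0 \<le> i \<Longrightarrow> i < k \<Longrightarrow> \<not> True" for z k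
    proof -
      have "\<not> k0 < k" using that(3)[OF order_refl] by blast
      then have "k = k0" using that(2) by simp
      show ?thesis unfolding \<open>k = k0\<close> using that(1) by (intro star_mass) auto
    qed
    show "emeasure lebesgue (\<Union>G) \<le> ennreal (2 * ?R)"
      if G: "finite G" "G \<subseteq> {cell k z | k z. k0 \<le> k \<and> z \<in> W \<inter> slab \<and> True}" for G
    proof -
      have "\<Union>G \<subseteq> cube x0 L \<times> {t0 - T <..< t0 + T}"
      proof (rule Union_least)
        fix S assume "S \<in> G"
        then obtain k z where S: "S = cell k z" "k0 \<le> k" "z \<in> W" "z \<in> slab" using G(2) by auto
        show "S \<subseteq> cube x0 L \<times> {t0 - T <..< t0 + T}"
        proof
          fix y assume y: "y \<in> S"
          have "fst y \<in> cube x0 L"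
            using y cell_subset_lower_part[of k z] cell_in_slab(1)[OF S(4), of k]
            unfolding S(1) by (fastforce simp: lower_part_def)
          moreover have "snd y < t0 + T"
            using cell_time[of y k z] y tau_bounds(2)[of k z] S rho[of k] rho_pos[of k] by (auto simp: W_def)
          moreover have "t0 - T < snd y" using cell_in_slab(2)[OF S(4)] y S(1) by blast
          ultimately show "y \<in> cube x0 L \<times> {t0 - T <..< t0 + T}" by (auto simp: mem_Times_iff)
        qed
      qed
      then have "emeasure lebesgue (\<Union>G) \<le> emeasure lebesgue (cube x0 L \<times> {t0 - T <..< t0 + T})"
        by (intro emeasure_mono cube_times_sets) auto
      also have "\<dots> = ennreal (2 * ?R)"
        using L T_pos by (subst emeasure_cube_times_Ioo) (auto simp: algebra_simps)
      finally show ?thesis .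
    qed
  qed (auto simp: sets_mu)
  have "AE z in mu. z \<in> W \<longrightarrow> z \<in> U"
    unfolding mu_def
  proof (subst AE_density)
    show "AE z in lebesgue. 0 < ennreal (w z powr q) \<longrightarrow> z \<in> W \<longrightarrow> z \<in> U"
      using AE_slab
    proof eventually_elim
      case (elim z)
      then show ?case using U(2) T_pos by (auto simp: W_def)
    qed
  qed simp
  then have "emeasure mu W \<le> emeasure mu U"
    using U(1) by (intro emeasure_mono_AE) (auto simp: sets_mu)
  also note U(3)
  also have "ennreal (4 * (C1 * (M0 * \<alpha>)) powr q) * ennreal (2 * ?R)
      = ennreal (8 * M0 powr q * (C1 * \<alpha>) powr q * ?R)"
    using R M0 C1 alpha(1) by (subst ennreal_mult[symmetric]) (auto simp: powr_mult mult_ac)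
  finally have upper: "emeasure mu W \<le> ennreal (8 * M0 powr q * (C1 * \<alpha>) powr q * ?R)" .
  obtain a where a: "0 \<le> a" "emeasure nu (upper_part p x0 t0 L) = ennreal (a * ?R)"
    "emeasure mu (lower_part p x0 t0 L) \<le> ennreal ((C1 * a) powr q * ?R)"
    using RH[OF L, of x0 t0] unfolding mu_def nu_def T_def by auto
  have "a = \<alpha>"
    using a(1,2) alpha L T_pos by auto
  have "cube x0 L \<times> {t0 - T <..< t0 + T / 2} \<subseteq> lower_part p x0 t0 L \<union> W"
    by (auto simp: lower_part_def W_def T_def)
  then have "emeasure mu (cube x0 L \<times> {t0 - T <..< t0 + T / 2}) \<le> emeasure mu (lower_part p x0 t0 L \<union> W)"
    using W_sets by (intro emeasure_mono) (auto simp: sets_mu)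
  also have "\<dots> \<le> emeasure mu (lower_part p x0 t0 L) + emeasure mu W"
    using W_sets by (intro emeasure_subadditive) (auto simp: sets_mu)
  also have "\<dots> \<le> ennreal ((C1 * \<alpha>) powr q * ?R) + ennreal (8 * M0 powr q * (C1 * \<alpha>) powr q * ?R)"
    using a(3) \<open>a = \<alpha>\<close> upper by (intro add_mono) auto
  also have "\<dots> = ennreal ((1 + 8 * M0 powr q) * (C1 * \<alpha>) powr q * ?R)"
    using R by (subst ennreal_plus[symmetric]) (auto simp: distrib_right mult.assoc)
  finally show ?thesis by (simp add: M0_def)
qed

end

text \<open>\<open>lam\<close> is the base level; \<open>mass\<close> keeps generation
  \<open>k0\<close> from being stopped at levels \<open>j \<ge> 1\<close>. \<open>b\<close> is the
  number of generations forced per level, \<open>k0\<close> makes the gaps between consecutive boxes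
  wide enough, and lowering the level by \<open>m\<close> steps makes the small values of
  \<open>w\<close> account for at most half of a mean.\<close>

locale gehring = reverse_hoelder p L t0 x0 w q C1
  for p L t0 :: real and x0 :: "real ^ 'n" and w q C1 +
  fixes lam b :: real and k0 m :: nat
  assumes lam: "0 < lam"
    and b: "b = q / (CARD('n) + nat \<lceil>p\<rceil>)"
    and k0: "4 / 2 ^ k0 \<le> 1 - 2 powr (- b)"
    and m: "1 \<le> m" "8 * C1 \<le> 2 ^ m"
    and mass: "emeasure mu (cube x0 L \<times> {t0 - T <..< t0 + T / 2})
        \<le> ennreal (lam powr q * (len k0 ^ CARD('n) * h k0))"
begin

text \<open>The level sets \<open>A j\<close> live in boxes \<open>V j\<close> that shrink towards the lower part: a stopped cell
  of level \<open>2 ^ j * lam\<close> is so small that its upper rectangle fits into \<open>V (j - 1)\<close>.\<close>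

definition height :: "nat \<Rightarrow> real" where "height j = t0 + T / 2 * 2 powr (- (b * j))"
definition V :: "nat \<Rightarrow> ((real ^ 'n) \<times> real) set" where
  "V j = cube x0 L \<times> {t0 - T <..< height j}"
definition A :: "nat \<Rightarrow> ((real ^ 'n) \<times> real) set" where
  "A j = {z \<in> V j. 2 ^ j * lam < w z}"
definition D :: real where "D = 2 ^ (CARD('n) + nat \<lceil>p\<rceil>)"
definition bad :: "nat \<Rightarrow> ((real ^ 'n) \<times> real) set \<Rightarrow> bool" where
  "bad j S \<longleftrightarrow> ennreal ((2 ^ j * lam) powr q) * emeasure lebesgue S < emeasure mu S"

section \<open>Depth and position of the stopped cells\<close>

lemma b_pos: "0 < b" using q by (simp add: b add_pos_nonneg)

lemma V_sets [measurable]: "V j \<in> sets lebesgue"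
  unfolding V_def by (rule cube_times_sets) simp

lemma A_sets [measurable]: "A j \<in> sets lebesgue"
proof -
  have "{z \<in> space lebesgue. z \<in> V j \<and> 2 ^ j * lam < w z} \<in> sets lebesgue" by measurable
  then show ?thesis by (simp add: A_def)
qed

lemma height_antimono: "i \<le> j \<Longrightarrow> height j \<le> height i"
  using b_pos T_pos by (simp add: height_def)

lemma V_antimono: "i \<le> j \<Longrightarrow> V j \<subseteq> V i"
  using height_antimono[of i j] by (auto simp: V_def)

lemma A_antimono:
  assumes "i \<le> j"
  shows "A j \<subseteq> A i"
proof -
  have "2 ^ i * lam \<le> 2 ^ j * lam" using assms lam by (intro mult_right_mono power_increasing) auto
  then show ?thesis using V_antimono[OF assms] by (auto simp: A_def)
qed

text \<open>With v = 2^(-b), the gap is proportional to 1/v - 1, and 1/v >= 2 - v bounds it below by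
  1 - v, which is the quantity controlled by \<open>k0\<close>. The factor 2 leaves room for the
  offset of \<open>tau\<close> and for the height of the upper rectangle.\<close>

lemma height_diff:
  assumes "1 \<le> j"
  shows "height j + 2 * (T / 2 ^ k0 * 2 powr (- (b * j))) \<le> height (j - 1)"
proof -
  let ?u = "2 powr (- (b * j))" and ?v = "2 powr (- b)"
  have v: "?v \<le> 1" "0 < ?v" using b_pos by (auto simp: powr_le_one_le intro: order_trans[OF powr_mono[of _ 0]])
  have "- (b * real (j - 1)) = - (b * j) - (- b)" using assms by (simp add: of_nat_diff algebra_simps)
  then have "2 powr (- (b * real (j - 1))) = ?u / ?v" by (simp only: powr_diff)
  moreover have "?u * (2 - ?v) \<le> ?u / ?v"
  proof -
    have "?v * (2 - ?v) \<le> 1" using sum_squares_ge_zero[of "1 - ?v" 0] by (simp add: algebra_simps)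
    then have "?u * (?v * (2 - ?v)) \<le> ?u * 1" by (intro mult_left_mono) auto
    then show ?thesis using v(2) by (simp only: pos_le_divide_eq) (simp only: mult_ac mult_1_right)
  qed
  ultimately have "height j + T / 2 * (?u * (1 - ?v)) \<le> height (j - 1)"
    using T_pos mult_left_mono[of "?u * (2 - ?v)" "?u / ?v" "T / 2"]
    by (simp add: height_def algebra_simps)
  moreover have "T / 2 * ?u * (4 / 2 ^ k0) \<le> T / 2 * ?u * (1 - ?v)"
    using T_pos k0 by (intro mult_left_mono) auto
  moreover have "T / 2 * ?u * (4 / 2 ^ k0) = 2 * (T / 2 ^ k0 * ?u)" by simp
  ultimately show ?thesis by (simp only: mult.assoc)
qed

text \<open>The cell cannot leave \<open>V 0\<close>, because the gap above \<open>V 1\<close> is at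
  least \<open>2 * rho k\<close>; so its mass is bounded by the total mass, written through the
  volume of generation \<open>k0\<close> to be compared with thresholds.\<close>

lemma cell_mass_le:
  assumes j: "1 \<le> j" and z: "z \<in> V j" "z \<in> slab" and k: "k0 \<le> k"
  shows "emeasure mu (cell k z) \<le> ennreal (lam powr q) * emeasure lebesgue (cell k0 z)"
proof -
  have "rho k \<le> T / 2 ^ k" by (rule rho_le)
  also have "\<dots> \<le> T / 2 ^ k0" using k T_pos by (intro divide_left_mono power_increasing) auto
  finally have "2 * rho k \<le> T / 2 * (4 / 2 ^ k0)" by simp
  also have "\<dots> \<le> T / 2 * (1 - 2 powr (- b))" using T_pos k0 by (intro mult_left_mono) auto
  also have "\<dots> = height 0 - height 1" by (simp add: height_def algebra_simps)
  also have "\<dots> \<le> height 0 - height j" using height_antimono[OF j] by simp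
  finally have rho: "2 * rho k \<le> height 0 - height j" .
  have "cell k z \<subseteq> V 0"
  proof
    fix y assume y: "y \<in> cell k z"
    have "fst y \<in> cube x0 L"
      using y cell_subset_lower_part[of k z] cell_in_slab(1)[OF z(2), of k]
      by (fastforce simp: lower_part_def)
    moreover have "snd y < height 0"
      using cell_time[OF y] tau_bounds(2)[of k z] z(1) rho rho_pos[of k] by (auto simp: V_def)
    ultimately show "y \<in> V 0"
      using cell_in_slab(2)[OF z(2) y] by (auto simp: V_def mem_Times_iff)
  qed
  then have "emeasure mu (cell k z) \<le> emeasure mu (V 0)"
    by (intro emeasure_mono) (auto simp: sets_mu)
  also have "\<dots> \<le> ennreal (lam powr q * (len k0 ^ CARD('n) * h k0))"
    using mass by (simp add: V_def height_def)
  also have "\<dots> = ennreal (lam powr q) * emeasure lebesgue (cell k0 z)"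
    using len_pos[of k0] h_pos[of k0] by (simp add: emeasure_cell ennreal_mult)
  finally show ?thesis .
qed

text \<open>Large mean against bounded total mass: the volume ratio between generations
  \<open>k0\<close> and \<open>k\<close> must exceed 2^(j q), but it is at most
  \<open>D ^ (k - k0)\<close>. In particular \<open>k0 < k\<close>, so a stopped cell always has an
  admissible parent.\<close>

lemma bad_depth:
  assumes j: "1 \<le> j" and z: "z \<in> V j" "z \<in> slab" and k: "k0 \<le> k" and bad: "bad j (cell k z)"
  shows "b * j < real (k - k0)"
proof (rule ccontr)
  assume "\<not> b * j < real (k - k0)"
  then have "real (k - k0) \<le> b * j" by simp
  then have "real (CARD('n) + nat \<lceil>p\<rceil>) * real (k - k0) \<le> q * j"
  proof -
    define d where "d = real (CARD('n) + nat \<lceil>p\<rceil>)"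
    have "0 < d" by (simp add: d_def add_pos_nonneg)
    moreover have "b = q / d" by (simp add: b d_def)
    ultimately have "d * real (k - k0) \<le> d * (b * j)" "d * b = q"
      using mult_left_mono[OF \<open>real (k - k0) \<le> b * j\<close>, of d] by simp_all
    then have "d * real (k - k0) \<le> q * j" by (simp only: mult.assoc[symmetric])
    then show ?thesis by (simp only: d_def)
  qed
  then have "2 powr (real ((CARD('n) + nat \<lceil>p\<rceil>) * (k - k0))) \<le> 2 powr (q * j)"
    by (intro powr_mono) (auto simp del: of_nat_add)
  then have D: "D ^ (k - k0) \<le> (2 ^ j) powr q"
  proof -
    have "D ^ (k - k0) = 2 powr (real ((CARD('n) + nat \<lceil>p\<rceil>) * (k - k0)))"
      unfolding D_def by (subst powr_realpow) (auto simp only: power_mult)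
    moreover have "(2 ^ j) powr q = (2::real) powr (q * j)"
      by (subst powr_realpow[symmetric]) (auto simp: powr_powr mult.commute)
    ultimately show ?thesis using \<open>2 powr _ \<le> 2 powr (q * j)\<close> by simp
  qed
  have "emeasure mu (cell k z) \<le> ennreal (lam powr q) * emeasure lebesgue (cell k0 z)"
    using cell_mass_le assms by blast
  also have "\<dots> \<le> ennreal (lam powr q) * (ennreal (D ^ (k - k0)) * emeasure lebesgue (cell k z))"
    using emeasure_cell_add[of k0 z "k - k0"] k by (intro mult_left_mono) (auto simp: D_def)
  also have "\<dots> = ennreal (lam powr q * D ^ (k - k0)) * emeasure lebesgue (cell k z)"
    by (simp add: ennreal_mult D_def mult.assoc)
  also have "\<dots> \<le> ennreal ((2 ^ j * lam) powr q) * emeasure lebesgue (cell k z)"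
  proof (intro mult_right_mono ennreal_leI)
    show "lam powr q * D ^ (k - k0) \<le> (2 ^ j * lam) powr q"
      using D lam mult_left_mono[OF D, of "lam powr q"] by (simp add: powr_mult mult.commute)
  qed simp
  finally show False using bad by (simp add: bad_def)
qed

text \<open>Depth \<open>b * j\<close> gives \<open>rho k\<close> at most
  \<open>T / 2 ^ k0 * 2 powr (- (b * j))\<close>, and the upper rectangle reaches at most
  \<open>2 * rho k\<close> beyond \<open>z\<close>, which is what \<open>height_diff\<close> pays
  for.\<close>

lemma star_subset:
  assumes j: "m \<le> j" and z: "z \<in> V j" "z \<in> slab" and k: "k0 \<le> k" and bad: "bad j (cell k z)"
  shows "star (k, z) \<subseteq> V (j - m)"
proof
  fix y assume y: "y \<in> star (k, z)"
  have j1: "1 \<le> j" using j m(1) by simp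
  have "rho k \<le> T / 2 ^ k" by (rule rho_le)
  also have "\<dots> = T / 2 ^ k0 * 2 powr (- real (k - k0))"
  proof -
    have "(2::real) ^ k = 2 ^ k0 * 2 ^ (k - k0)" using k by (simp flip: power_add)
    then show ?thesis by (simp add: powr_minus powr_realpow divide_inverse del: of_nat_diff)
  qed
  also have "\<dots> \<le> T / 2 ^ k0 * 2 powr (- (b * j))"
    using bad_depth[OF j1 z k bad] T_pos by (intro mult_left_mono powr_mono) auto
  finally have "height j + 2 * rho k \<le> height (j - 1)" using height_diff[OF j1] by simp
  also have "\<dots> \<le> height (j - m)" using m(1) by (intro height_antimono) auto
  finally have "height j + 2 * rho k \<le> height (j - m)" .
  moreover have "snd y < tau k z + rho k" "tau k z < snd y" "fst y \<in> cube x0 L"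
    using y cell_in_slab(1)[OF z(2), of k] by (auto simp: star_def upper_part_def rho_def)
  moreover have "tau k z \<le> snd z + rho k" "snd z < tau k z" using tau_bounds by auto
  moreover have "snd z < height j" "t0 - T < snd z" using z by (auto simp: V_def)
  ultimately show "y \<in> V (j - m)" by (auto simp: V_def mem_Times_iff)
qed

text \<open>Badness and the reverse Hoelder inequality give a mean \<open>a\<close> of
  \<open>w\<close> with \<open>\<Lambda> < 4 * (C1 * a)\<close>. Values of \<open>w\<close> up to
  \<open>2 ^ (j - m) * lam\<close> contribute at most half of this because
  \<open>8 * C1 \<le> 2 ^ m\<close>; the other half comes from \<open>A (j - m)\<close>.\<close>

lemma bad_star:
  assumes j: "m \<le> j" and z: "z \<in> V j" "z \<in> slab" and k: "k0 \<le> k" and bad: "bad j (cell k z)"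
  shows "ennreal (2 ^ j * lam) * emeasure lebesgue (star (k, z))
    \<le> ennreal (8 * C1) * emeasure nu (star (k, z) \<inter> A (j - m))"
proof -
  let ?\<Lambda> = "2 ^ j * lam" and ?\<Lambda>' = "2 ^ (j - m) * lam"
  define s where "s = len k ^ CARD('n) * rho k"
  have s: "0 < s" using len_pos[of k] rho_pos[of k] by (simp add: s_def)
  have \<Lambda>: "0 < ?\<Lambda>" "0 < ?\<Lambda>'" using lam by auto
  have es: "emeasure lebesgue (star (k, z)) = ennreal s"
    by (simp add: emeasure_star s_def)
  obtain a where a: "0 \<le> a" "emeasure nu (star (k, z)) = ennreal (a * s)"
    "emeasure mu (cell k z) \<le> ennreal (4 * (C1 * a) powr q) * emeasure lebesgue (cell k z)"
    unfolding s_def by (rule cell_reverse_hoelder)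
  define c where "c = len k ^ CARD('n) * h k"
  have c: "0 < c" "emeasure lebesgue (cell k z) = ennreal c"
    using len_pos[of k] h_pos[of k] by (auto simp: c_def emeasure_cell)
  have "ennreal (?\<Lambda> powr q * c) < ennreal (4 * (C1 * a) powr q * c)"
    using less_le_trans[OF bad[unfolded bad_def] a(3)] c by (simp add: ennreal_mult)
  then have "?\<Lambda> powr q < 4 * (C1 * a) powr q"
    using c(1) by (simp add: ennreal_less_iff)
  \<comment> \<open>The 4 is moved inside the power, using \<open>q > 1\<close>, so that the root
    can be taken.\<close>
  also have "\<dots> \<le> (4 * (C1 * a)) powr q"
  proof -
    have "(4::real) = 4 powr 1" by simp
    also have "\<dots> \<le> 4 powr q" using q by (intro powr_mono) auto
    finally have "(4::real) \<le> 4 powr q" .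
    then have "4 * (C1 * a) powr q \<le> 4 powr q * (C1 * a) powr q" by (intro mult_right_mono) auto
    also have "\<dots> = (4 * (C1 * a)) powr q" using C1 a(1) by (simp add: powr_mult)
    finally show ?thesis .
  qed
  finally have "?\<Lambda> powr q < (4 * (C1 * a)) powr q" .
  then have \<Lambda>a: "?\<Lambda> < 4 * (C1 * a)"
    using powr_mono2[of q "4 * (C1 * a)" ?\<Lambda>] q C1 a(1) lam by (meson leI leD less_imp_le mult_nonneg_nonneg order_trans zero_le_numeral zero_less_one)
  have "emeasure nu (star (k, z) \<inter> A (j - m)) \<le> emeasure nu (star (k, z))"
    by (intro emeasure_mono) (auto simp: sets_nu)
  also have "\<dots> < \<infinity>" by (simp add: a(2))
  finally obtain I where I: "0 \<le> I" "emeasure nu (star (k, z) \<inter> A (j - m)) = ennreal I"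
    by (cases "emeasure nu (star (k, z) \<inter> A (j - m))") auto
  have "ennreal (a * s) = (\<integral>\<^sup>+y. ennreal (w y) * indicator (star (k, z)) y \<partial>lebesgue)"
    unfolding a(2)[symmetric] nu_def by (rule emeasure_density) auto
  also have "\<dots> \<le> (\<integral>\<^sup>+y. ennreal ?\<Lambda>' * indicator (star (k, z)) y
      + ennreal (w y) * indicator (star (k, z) \<inter> A (j - m)) y \<partial>lebesgue)"
  proof (rule nn_integral_mono)
    fix y
    show "ennreal (w y) * indicator (star (k, z)) y \<le> ennreal ?\<Lambda>' * indicator (star (k, z)) y
      + ennreal (w y) * indicator (star (k, z) \<inter> A (j - m)) y"
      using star_subset[OF assms] by (auto simp: A_def split: split_indicator intro!: ennreal_leI)
  qed
  also have "\<dots> = ennreal ?\<Lambda>' * emeasure lebesgue (star (k, z)) + emeasure nu (star (k, z) \<inter> A (j - m))"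
    unfolding nu_def by (subst nn_integral_add) (auto simp: nn_integral_cmult_indicator emeasure_density)
  also have "\<dots> = ennreal (?\<Lambda>' * s + I)"
    using \<Lambda> s I by (simp add: es ennreal_mult)
  finally have "a * s \<le> ?\<Lambda>' * s + I" using \<Lambda> s I(1) by (subst (asm) ennreal_le_iff) (auto simp del: ennreal_plus)
  then have "4 * C1 * (a * s) \<le> 4 * C1 * (?\<Lambda>' * s + I)" using C1 by (intro mult_left_mono) auto
  moreover have "?\<Lambda> * s \<le> 4 * (C1 * a) * s" using \<Lambda>a s by (intro mult_right_mono) auto
  moreover have "8 * C1 * (?\<Lambda>' * s) \<le> ?\<Lambda> * s"
  proof -
    have "8 * C1 * (?\<Lambda>' * s) \<le> 2 ^ m * (?\<Lambda>' * s)" using m(2) \<Lambda> s by (intro mult_right_mono) auto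
    also have "\<dots> = ?\<Lambda> * s" using j by (simp add: mult.assoc[symmetric] flip: power_add)
    finally show ?thesis .
  qed
  ultimately have "?\<Lambda> * s \<le> 8 * C1 * I" by (simp add: algebra_simps)
  then show ?thesis
    unfolding es I(2) using \<Lambda> s I(1) C1 by (simp flip: ennreal_mult)
qed

lemma bad_family_measure:
  assumes j: "m \<le> j" and fin: "finite G"
    and G: "G \<subseteq> {cell k z | k z. k0 \<le> k \<and> z \<in> V j \<inter> slab \<and> bad j (cell k z)}"
  shows "emeasure lebesgue (\<Union>G)
    \<le> ennreal (3 ^ (CARD('n) + 1) * (8 * C1) / (2 ^ j * lam)) * emeasure nu (A (j - m))"
proof -
  let ?\<Lambda> = "2 ^ j * lam"
  have \<Lambda>: "0 < ?\<Lambda>" using lam by simp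
  define X where "X = {i. k0 \<le> fst i \<and> snd i \<in> V j \<inter> slab \<and> bad j (cell (fst i) (snd i))}"
  have "G \<subseteq> (\<lambda>i. cell (fst i) (snd i)) ` X"
  proof
    fix S assume "S \<in> G"
    then obtain k z where "S = cell k z" "k0 \<le> k" "z \<in> V j \<inter> slab" "bad j (cell k z)"
      using G by blast
    then show "S \<in> (\<lambda>i. cell (fst i) (snd i)) ` X"
      by (intro image_eqI[of _ _ "(k, z)"]) (auto simp: X_def)
  qed
  \<comment> \<open>One representative index is chosen for each of the finitely many cells.\<close>
  then obtain I where I: "I \<subseteq> X" "finite I" "G = (\<lambda>i. cell (fst i) (snd i)) ` I"
    using finite_subset_image[OF fin, of "\<lambda>i. cell (fst i) (snd i)" X] by blast
  obtain J where J: "J \<subseteq> I" "disjoint_family_on star J"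
    "emeasure lebesgue (\<Union>i\<in>I. cell (fst i) (snd i))
      \<le> ennreal (3 ^ (CARD('n) + 1)) * (\<Sum>i\<in>J. emeasure lebesgue (star i))"
    using vitali_cells[OF I(2)] by blast
  have fJ: "finite J" using J(1) I(2) finite_subset by blast
  have "ennreal ?\<Lambda> * (\<Sum>i\<in>J. emeasure lebesgue (star i)) = (\<Sum>i\<in>J. ennreal ?\<Lambda> * emeasure lebesgue (star i))"
    by (rule sum_distrib_left)
  also have "\<dots> \<le> (\<Sum>i\<in>J. ennreal (8 * C1) * emeasure nu (star i \<inter> A (j - m)))"
  proof (rule sum_mono)
    fix i assume "i \<in> J"
    then have "i \<in> X" using J(1) I(1) by blast
    then show "ennreal ?\<Lambda> * emeasure lebesgue (star i) \<le> ennreal (8 * C1) * emeasure nu (star i \<inter> A (j - m))"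
      using bad_star[OF j, of "snd i" "fst i"] by (simp add: X_def)
  qed
  also have "\<dots> = ennreal (8 * C1) * (\<Sum>i\<in>J. emeasure nu (star i \<inter> A (j - m)))"
    by (rule sum_distrib_left[symmetric])
  also have "(\<Sum>i\<in>J. emeasure nu (star i \<inter> A (j - m))) = emeasure nu (\<Union>i\<in>J. star i \<inter> A (j - m))"
    
  proof (rule sum_emeasure)
    show "disjoint_family_on (\<lambda>i. star i \<inter> A (j - m)) J"
      using J(2) unfolding disjoint_family_on_def by blast
  qed (use fJ in \<open>auto simp: sets_nu\<close>)
  also have "ennreal (8 * C1) * \<dots> \<le> ennreal (8 * C1) * emeasure nu (A (j - m))"
    by (intro mult_left_mono emeasure_mono) (auto simp: sets_nu)
  finally have sum: "ennreal ?\<Lambda> * (\<Sum>i\<in>J. emeasure lebesgue (star i)) \<le> ennreal (8 * C1) * emeasure nu (A (j - m))" .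
  have "emeasure lebesgue (\<Union>G) \<le> ennreal (3 ^ (CARD('n) + 1)) * (\<Sum>i\<in>J. emeasure lebesgue (star i))"
    using J(3) by (simp add: I(3))
  also have "\<dots> = ennreal (3 ^ (CARD('n) + 1) / ?\<Lambda>) * (ennreal ?\<Lambda> * (\<Sum>i\<in>J. emeasure lebesgue (star i)))"
    unfolding mult.assoc[symmetric] using \<Lambda> by (subst ennreal_mult[symmetric]) auto
  also have "\<dots> \<le> ennreal (3 ^ (CARD('n) + 1) / ?\<Lambda>) * (ennreal (8 * C1) * emeasure nu (A (j - m)))"
    using sum by (rule mult_left_mono) simp
  also have "\<dots> = ennreal (3 ^ (CARD('n) + 1) * (8 * C1) / ?\<Lambda>) * emeasure nu (A (j - m))"
    unfolding mult.assoc[symmetric] using \<Lambda> C1 by (subst ennreal_mult[symmetric]) (auto simp: mult.assoc)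
  finally show ?thesis .
qed

text \<open>The parent of a first bad cell is not bad, so mu is at most
  \<open>D * \<Lambda> powr q\<close> times volume on the cover; \<open>bad_family_measure\<close>
  bounds that volume with a factor \<open>1 / \<Lambda>\<close>. Their product yields the exponent
  \<open>q - 1\<close>.\<close>

lemma level_estimate:
  assumes j: "m \<le> j"
  shows "emeasure mu (A j)
    \<le> ennreal (8 * C1 * 3 ^ (CARD('n) + 1) * D * (2 ^ j * lam) powr (q - 1)) * emeasure nu (A (j - m))"
proof -
  let ?\<Lambda> = "2 ^ j * lam"
  have \<Lambda>: "0 < ?\<Lambda>" using lam by simp
  have j1: "1 \<le> j" using j m(1) by simp
  define E where "E = {z \<in> V j \<inter> slab. \<exists>k\<ge>k0. bad j (cell k z)}"
  obtain U where U: "U \<in> sets lebesgue" "E \<subseteq> U"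
    "emeasure mu U \<le> ennreal (?\<Lambda> powr q * D) *
      (ennreal (3 ^ (CARD('n) + 1) * (8 * C1) / ?\<Lambda>) * emeasure nu (A (j - m)))"
  proof (rule stopping_cover[where P = "bad j" and E = E and ?k0.0 = k0])
    show "\<exists>k\<ge>k0. bad j (cell k z)" if "z \<in> E" for z using that by (simp add: E_def)
    show "emeasure mu (cell k z) \<le> ennreal (?\<Lambda> powr q * D) * emeasure lebesgue (cell k z)"
      if z: "z \<in> E" and k: "k0 \<le> k" "bad j (cell k z)" "\<And>i. k0 \<le> i \<Longrightarrow> i < k \<Longrightarrow> \<not> bad j (cell i z)" for z k
    proof -
      \<comment> \<open>The first bad generation is not \<open>k0\<close>, so minimality does apply
        to the parent \<open>i\<close>.\<close>
      have "b * j < real (k - k0)" using z k by (intro bad_depth[OF j1]) (auto simp: E_def)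
      moreover have "0 < b * j" using b_pos j1 by simp
      ultimately have "k0 < k" by (cases "k0 < k") auto
      then obtain i where i: "k = Suc i" "k0 \<le> i" by (cases k) auto
      then have nb: "\<not> bad j (cell i z)" using k(3) by simp
      have "emeasure mu (cell k z) \<le> emeasure mu (cell i z)"
        using cell_mono[of i k z] i by (intro emeasure_mono) (auto simp: sets_mu)
      also have "\<dots> \<le> ennreal (?\<Lambda> powr q) * emeasure lebesgue (cell i z)"
        using nb by (simp add: bad_def)
      also have "\<dots> \<le> ennreal (?\<Lambda> powr q) * (ennreal D * emeasure lebesgue (cell k z))"
        unfolding D_def i(1) by (intro mult_left_mono emeasure_cell_Suc) auto
      also have "\<dots> = ennreal (?\<Lambda> powr q * D) * emeasure lebesgue (cell k z)"
        by (simp add: ennreal_mult D_def mult.assoc)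
      finally show ?thesis .
    qed
    show "emeasure lebesgue (\<Union>G) \<le> ennreal (3 ^ (CARD('n) + 1) * (8 * C1) / ?\<Lambda>) * emeasure nu (A (j - m))"
      if "finite G" "G \<subseteq> {cell k z | k z. k0 \<le> k \<and> z \<in> E \<and> bad j (cell k z)}" for G
    proof (rule bad_family_measure[OF j that(1)])
      have "{cell k z | k z. k0 \<le> k \<and> z \<in> E \<and> bad j (cell k z)}
        \<subseteq> {cell k z | k z. k0 \<le> k \<and> z \<in> V j \<inter> slab \<and> bad j (cell k z)}"
        unfolding E_def by blast
      then show "G \<subseteq> {cell k z | k z. k0 \<le> k \<and> z \<in> V j \<inter> slab \<and> bad j (cell k z)}"
        using that(2) by simp
    qed
  qed (auto simp: sets_mu)
  have "AE z in lebesgue. z \<in> A j \<longrightarrow> z \<in> U"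
  proof -
    have "emeasure lebesgue (A j) \<le> emeasure lebesgue (V 0)"
      using V_antimono[of 0 j] by (intro emeasure_mono) (auto simp: A_def)
    also have "\<dots> < \<infinity>"
      unfolding V_def using L T_pos by (subst emeasure_cube_times_Ioo) (auto simp: height_def)
    finally have fin: "emeasure lebesgue (A j) < \<infinity>" .
    have "AE z in lebesgue. z \<in> A j \<longrightarrow> (\<exists>k\<ge>k0. bad j (cell k z))"
      unfolding bad_def mu_def
    proof (rule AE_cell_average_gt[OF _ A_sets fin])
      show "?\<Lambda> powr q < w z powr q" if "z \<in> A j" for z
        using that q \<Lambda> by (intro powr_less_mono2) (auto simp: A_def)
    qed auto
    with AE_slab show ?thesis
    proof eventually_elim
      case (elim z)
      show ?case
      proof
        assume z: "z \<in> A j"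
        then have "z \<in> V j" by (simp add: A_def)
        then have "z \<in> slab" using elim(1) by (auto simp: V_def)
        then show "z \<in> U" using \<open>z \<in> V j\<close> z elim(2) U(2) by (auto simp: E_def)
      qed
    qed
  qed
  then have "AE z in mu. z \<in> A j \<longrightarrow> z \<in> U"
    unfolding mu_def by (subst AE_density) auto
  then have "emeasure mu (A j) \<le> emeasure mu U"
    using U(1) by (intro emeasure_mono_AE) (auto simp: sets_mu)
  also note U(3)
  also have "ennreal (?\<Lambda> powr q * D) * (ennreal (3 ^ (CARD('n) + 1) * (8 * C1) / ?\<Lambda>) * emeasure nu (A (j - m)))
    = ennreal (?\<Lambda> powr q * D * (3 ^ (CARD('n) + 1) * (8 * C1) / ?\<Lambda>)) * emeasure nu (A (j - m))"
    unfolding mult.assoc[symmetric] using \<Lambda> C1 by (subst ennreal_mult[symmetric]) (auto simp: D_def)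
  also have "?\<Lambda> powr q * D * (3 ^ (CARD('n) + 1) * (8 * C1) / ?\<Lambda>)
    = 8 * C1 * 3 ^ (CARD('n) + 1) * D * ?\<Lambda> powr (q - 1)"
    using \<Lambda> by (simp add: powr_diff)
  finally show ?thesis .
qed

end

section \<open>Summation over the levels\<close>

text \<open>The absorption at a single point, with \<open>S j\<close> for membership in
  \<open>A j\<close> and \<open>u\<close> for the value of \<open>w\<close>. Let \<open>M\<close> be
  the top level. The left side is geometric and comparable to its top term, at most
  \<open>G * \<Lambda> powr \<epsilon> * u powr q\<close> with
  \<open>\<Lambda> = 2 ^ M * lam < u\<close>; on the right the levels \<open>M - N0\<close> to
  \<open>M\<close> each give at least half of this without \<open>G\<close>, since 2^(N0 \<epsilon>)
  = 2.\<close>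

lemma geometric_level_sum:
  fixes q lam u :: real and N0 m J :: nat and S :: "nat \<Rightarrow> bool"
  assumes q: "1 < q" and lam: "0 < lam" and N0: "1 \<le> N0" and eps: "\<epsilon> = 1 / N0"
    and mono: "\<And>i j. i \<le> j \<Longrightarrow> S j \<Longrightarrow> S i" and S: "\<And>j. S j \<Longrightarrow> 2 ^ j * lam < u"
    and u: "0 \<le> u" and G: "G = 2 powr (q * (m + 1)) / (2 powr (q - 1) - 1)"
  shows "(\<Sum>j\<in>{N0 + m..<J}. (2 ^ j * lam) powr (q - 1 + \<epsilon>) * (if S (j - m) then u else 0))
    \<le> 2 * G / (N0 + 1) * (\<Sum>j<J. (2 ^ j * lam) powr \<epsilon> * (if S j then u powr q else 0))"
    (is "?lhs \<le> ?c * ?rhs")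
proof -
  have e: "0 < \<epsilon>" "\<epsilon> \<le> 1" using N0 eps by auto
  have "2 powr 0 < 2 powr (q - 1)" using q by (subst powr_less_cancel_iff) auto
  then have q1: "1 < 2 powr (q - 1)" by simp
  then have G_pos: "0 < G" unfolding G by simp
  show ?thesis
  proof (cases "\<exists>j\<in>{N0 + m..<J}. S (j - m)")
    case False
    then have "?lhs = 0" by (intro sum.neutral) auto
    moreover have "0 \<le> ?rhs" by (intro sum_nonneg) auto
    ultimately show ?thesis using G_pos by simp
  next
    case True
    then obtain j1 where j1: "N0 + m \<le> j1" "j1 < J" "S (j1 - m)" by auto
    define M where "M = Max {j. j < J \<and> S j}"
    have fin: "finite {j. j < J \<and> S j}" by simp
    have mem: "j1 - m \<in> {j. j < J \<and> S j}" using j1 by auto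
    have M: "M < J" "S M" using Max_in[OF fin] mem unfolding M_def by blast+
    have "j1 - m \<le> M" unfolding M_def using fin mem by (rule Max_ge)
    \<comment> \<open>This is why the left sum starts at \<open>N0 + m\<close>: all
      \<open>N0 + 1\<close> levels below and including the top must exist.\<close>
    then have MN: "N0 \<le> M" using j1(1) by simp
    have S_iff: "S j \<longleftrightarrow> j \<le> M" if "j < J" for j
    proof
      show "j \<le> M" if "S j" unfolding M_def using fin \<open>j < J\<close> that by (intro Max_ge) auto
      show "S j" if "j \<le> M" using mono[OF that M(2)] .
    qed
    let ?\<Lambda> = "2 ^ M * lam"
    have \<Lambda>: "0 < ?\<Lambda>" "?\<Lambda> < u" using lam S[OF M(2)] by auto
    define a where "a = q - 1 + \<epsilon>"
    define r where "r = 2 powr a"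
    have r1: "2 powr (q - 1) \<le> r" unfolding r_def a_def using e by (intro powr_mono) auto
    have r2: "r \<le> 2 powr q" unfolding r_def a_def using e by (intro powr_mono) auto
    have r0: "1 < r" using q1 r1 by simp
    have level: "(2 ^ j * lam) powr a = lam powr a * r ^ j" for j
    proof -
      have "(2 ^ j :: real) powr a = r ^ j"
        unfolding r_def by (simp add: powr_powr mult.commute flip: powr_realpow)
      then show ?thesis using lam by (simp add: powr_mult)
    qed
    have "?lhs \<le> (\<Sum>j\<in>{N0 + m..<J} \<inter> {..<M + m + 1}. (2 ^ j * lam) powr a * u)"
    proof -
      have "?lhs = (\<Sum>j\<in>{N0 + m..<J} \<inter> {..<M + m + 1}. (2 ^ j * lam) powr a * (if S (j - m) then u else 0))"
        unfolding a_def using S_iff by (intro sum.mono_neutral_right) auto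
      also have "\<dots> \<le> (\<Sum>j\<in>{N0 + m..<J} \<inter> {..<M + m + 1}. (2 ^ j * lam) powr a * u)"
        using u by (intro sum_mono mult_left_mono) auto
      finally show ?thesis .
    qed
    also have "\<dots> \<le> (\<Sum>j<M + m + 1. (2 ^ j * lam) powr a * u)"
      using u by (intro sum_mono2) auto
    also have "\<dots> = lam powr a * u * (\<Sum>j<M + m + 1. r ^ j)"
      unfolding level by (simp only: sum_distrib_left mult_ac)
    also have "(\<Sum>j<M + m + 1. r ^ j) = (r ^ (M + m + 1) - 1) / (r - 1)"
      using r0 by (intro geometric_sum) auto
    also have "lam powr a * u * \<dots> \<le> lam powr a * u * (r ^ M * (r ^ (m + 1) / (r - 1)))"
      using r0 u by (intro mult_left_mono) (auto simp: power_add divide_right_mono)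
    also have "\<dots> = ?\<Lambda> powr a * u * (r ^ (m + 1) / (r - 1))"
      unfolding level by (simp add: mult_ac)
    \<comment> \<open>\<open>r\<close> is replaced by bounds without \<epsilon>, from above in the
      numerator and from below in the denominator. So \<open>G\<close> does not depend on
      \<open>N0\<close>, and \<open>N0\<close> can later be chosen in terms of
      \<open>G\<close>.\<close>
    also have "\<dots> \<le> ?\<Lambda> powr a * u * G"
    proof (intro mult_left_mono)
      have "r ^ (m + 1) \<le> (2 powr q) ^ (m + 1)" using r2 r0 by (intro power_mono) auto
      also have "\<dots> = (2 powr q) powr real (m + 1)" by (rule powr_realpow[symmetric]) simp
      also have "\<dots> = 2 powr (q * (m + 1))" by (simp only: powr_powr)
      finally show "r ^ (m + 1) / (r - 1) \<le> G"
        unfolding G using q1 r1 by (intro frac_le) auto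
    qed (use u in auto)
    also have "?\<Lambda> powr a * u * G \<le> ?\<Lambda> powr \<epsilon> * u powr q * G"
    proof (intro mult_right_mono)
      have "?\<Lambda> powr a * u = ?\<Lambda> powr \<epsilon> * (?\<Lambda> powr (q - 1) * u powr 1)"
        unfolding a_def using \<Lambda> by (simp add: powr_add)
      also have "\<dots> \<le> ?\<Lambda> powr \<epsilon> * (u powr (q - 1) * u powr 1)"
        using \<Lambda> q by (intro mult_left_mono mult_right_mono powr_mono2) auto
      also have "\<dots> = ?\<Lambda> powr \<epsilon> * u powr q" by (simp only: powr_add[symmetric]) simp
      finally show "?\<Lambda> powr a * u \<le> ?\<Lambda> powr \<epsilon> * u powr q" .
    qed (use G_pos in auto)
    finally have lhs: "?lhs \<le> ?\<Lambda> powr \<epsilon> * u powr q * G" .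
    have "(N0 + 1) * (?\<Lambda> powr \<epsilon> / 2 * u powr q) = (\<Sum>j\<in>{M - N0..M}. ?\<Lambda> powr \<epsilon> / 2 * u powr q)"
      using MN by simp
    also have "\<dots> \<le> (\<Sum>j\<in>{M - N0..M}. (2 ^ j * lam) powr \<epsilon> * u powr q)"
    proof (intro sum_mono mult_right_mono)
      fix j assume "j \<in> {M - N0..M}"
      then have "(2::real) ^ M \<le> 2 ^ (N0 + j)" by (intro power_increasing) auto
      then have "?\<Lambda> \<le> 2 ^ N0 * (2 ^ j * lam)" using lam by (simp add: power_add)
      then have "?\<Lambda> powr \<epsilon> \<le> (2 ^ N0 * (2 ^ j * lam)) powr \<epsilon>"
        using e \<Lambda> by (intro powr_mono2) auto
      also have "\<dots> = (2 ^ N0) powr \<epsilon> * (2 ^ j * lam) powr \<epsilon>" using lam by (simp add: powr_mult)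
      also have "(2 ^ N0) powr \<epsilon> = (2::real)"
        unfolding eps using N0 by (simp add: powr_powr flip: powr_realpow)
      finally show "?\<Lambda> powr \<epsilon> / 2 \<le> (2 ^ j * lam) powr \<epsilon>" by simp
    qed simp
    also have "\<dots> = (\<Sum>j\<in>{M - N0..M}. (2 ^ j * lam) powr \<epsilon> * (if S j then u powr q else 0))"
      using S_iff M(1) by (intro sum.cong) auto
    also have "\<dots> \<le> ?rhs"
      using M(1) by (intro sum_mono2) auto
    finally have "?c * ((N0 + 1) * (?\<Lambda> powr \<epsilon> / 2 * u powr q)) \<le> ?c * ?rhs"
      using G_pos by (intro mult_left_mono) auto
    moreover have "2 * G / real (N0 + 1) * (real (N0 + 1) * (X / 2 * Y)) = X * Y * G" for X Y
      by (simp del: of_nat_add of_nat_Suc)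
    ultimately have "?\<Lambda> powr \<epsilon> * u powr q * G \<le> ?c * ?rhs" by (simp only:)
    with lhs show ?thesis by (rule order_trans)
  qed
qed

section \<open>Absorption of the level sums and the higher integrability\<close>

context gehring
begin

text \<open>A truncated layer cake sum standing in for w^(q + \<epsilon>) above level
  \<open>lam\<close>. The truncation at \<open>J\<close> keeps its integral finite.\<close>

definition Phi :: "real \<Rightarrow> nat \<Rightarrow> (real ^ 'n) \<times> real \<Rightarrow> real" where
  "Phi \<epsilon> J z = (\<Sum>j<J. (2 ^ j * lam) powr \<epsilon> * (if z \<in> A j then w z powr q else 0))"

lemma Phi_nonneg: "0 \<le> Phi \<epsilon> J z"
  unfolding Phi_def by (intro sum_nonneg) auto

lemma nn_integral_Phi:
  "(\<integral>\<^sup>+z. ennreal (Phi \<epsilon> J z) \<partial>lebesgue) = (\<Sum>j<J. ennreal ((2 ^ j * lam) powr \<epsilon>) * emeasure mu (A j))"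
proof -
  have "(\<integral>\<^sup>+z. ennreal (Phi \<epsilon> J z) \<partial>lebesgue)
    = (\<integral>\<^sup>+z. (\<Sum>j<J. ennreal ((2 ^ j * lam) powr \<epsilon>) * (ennreal (w z powr q) * indicator (A j) z)) \<partial>lebesgue)"
  proof (rule nn_integral_cong)
    fix z
    have "ennreal (Phi \<epsilon> J z) = (\<Sum>j<J. ennreal ((2 ^ j * lam) powr \<epsilon> * (if z \<in> A j then w z powr q else 0)))"
      unfolding Phi_def by (rule sum_ennreal[symmetric]) auto
    also have "\<dots> = (\<Sum>j<J. ennreal ((2 ^ j * lam) powr \<epsilon>) * (ennreal (w z powr q) * indicator (A j) z))"
      by (intro sum.cong) (auto simp: ennreal_mult split: split_indicator)
    finally show "ennreal (Phi \<epsilon> J z) = (\<Sum>j<J. ennreal ((2 ^ j * lam) powr \<epsilon>) * (ennreal (w z powr q) * indicator (A j) z))" .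
  qed
  also have "\<dots> = (\<Sum>j<J. ennreal ((2 ^ j * lam) powr \<epsilon>) * (\<integral>\<^sup>+z. ennreal (w z powr q) * indicator (A j) z \<partial>lebesgue))"
    by (subst nn_integral_sum) (auto simp: nn_integral_cmult)
  also have "\<dots> = (\<Sum>j<J. ennreal ((2 ^ j * lam) powr \<epsilon>) * emeasure mu (A j))"
    unfolding mu_def by (simp add: emeasure_density)
  finally show ?thesis .
qed

lemma mu_V0: "emeasure mu (V 0) \<le> ennreal (lam powr q * (len k0 ^ CARD('n) * h k0))"
  using mass by (simp add: V_def height_def)

text \<open>Levels below \<open>N0 + m\<close> are bounded by the total mass. The others return,
  through \<open>level_estimate\<close> and the pointwise absorption, as at most half of the whole
  integral. The bound is uniform in \<open>J\<close>.\<close>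

lemma Phi_bound:
  fixes N0 :: nat
  assumes N0: "1 \<le> N0" and eps: "\<epsilon> = 1 / N0"
    and small: "8 * C1 * 3 ^ (CARD('n) + 1) * D * (2 * (2 powr (q * (m + 1)) / (2 powr (q - 1) - 1)) / (N0 + 1)) \<le> 1 / 2"
  shows "(\<integral>\<^sup>+z. ennreal (Phi \<epsilon> J z) \<partial>lebesgue)
    \<le> ennreal (2 * real (N0 + m) * (2 ^ (N0 + m) * lam) powr \<epsilon>) * emeasure mu (V 0)"
proof -
  define C2 where "C2 = 8 * C1 * 3 ^ (CARD('n) + 1) * D"
  define G where "G = 2 powr (q * (m + 1)) / (2 powr (q - 1) - 1)"
  define j0 where "j0 = N0 + m"
  have C2: "0 \<le> C2" using C1 by (simp add: C2_def D_def)
  have e: "0 < \<epsilon>" using N0 eps by simp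
  have muA: "emeasure mu (A j) \<le> emeasure mu (V 0)" for j
    using V_antimono[of 0 j] by (intro emeasure_mono) (auto simp: A_def sets_mu)
  have fin: "emeasure mu (V 0) < \<infinity>" using mu_V0 by (auto intro: le_less_trans)
  let ?P = "\<lambda>j. ennreal ((2 ^ j * lam) powr \<epsilon>) * emeasure mu (A j)"
  define \<Psi> where "\<Psi> = (\<Sum>j<J. ?P j)"
  have "\<Psi> \<le> (\<Sum>j\<in>{..<j0} \<union> {j0..<J}. ?P j)"
    unfolding \<Psi>_def by (intro sum_mono2) auto
  also have "\<dots> = (\<Sum>j<j0. ?P j) + (\<Sum>j\<in>{j0..<J}. ?P j)"
    by (intro sum.union_disjoint) auto
  also have "(\<Sum>j<j0. ?P j) \<le> (\<Sum>j<j0. ennreal ((2 ^ j0 * lam) powr \<epsilon>) * emeasure mu (V 0))"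
    using e lam muA by (intro sum_mono mult_mono ennreal_leI powr_mono2 mult_right_mono power_increasing) auto
  also have "\<dots> = ennreal (j0 * (2 ^ j0 * lam) powr \<epsilon>) * emeasure mu (V 0)"
    by (simp add: ennreal_mult mult.assoc ennreal_of_nat_eq_real_of_nat)
  also have "(\<Sum>j\<in>{j0..<J}. ?P j) \<le> ennreal (1 / 2) * \<Psi>"
  proof -
    have "(\<Sum>j\<in>{j0..<J}. ?P j)
      \<le> (\<Sum>j\<in>{j0..<J}. ennreal C2 * (ennreal ((2 ^ j * lam) powr (q - 1 + \<epsilon>)) * emeasure nu (A (j - m))))"
    proof (rule sum_mono)
      fix j assume "j \<in> {j0..<J}"
      then have "m \<le> j" by (simp add: j0_def)
      have "?P j \<le> ennreal ((2 ^ j * lam) powr \<epsilon>) * (ennreal (C2 * (2 ^ j * lam) powr (q - 1)) * emeasure nu (A (j - m)))"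
        using level_estimate[OF \<open>m \<le> j\<close>] by (intro mult_left_mono) (auto simp: C2_def)
      also have "\<dots> = ennreal ((2 ^ j * lam) powr \<epsilon> * (C2 * (2 ^ j * lam) powr (q - 1))) * emeasure nu (A (j - m))"
        using C2 by (simp add: ennreal_mult mult.assoc)
      also have "(2 ^ j * lam) powr \<epsilon> * (C2 * (2 ^ j * lam) powr (q - 1)) = C2 * (2 ^ j * lam) powr (q - 1 + \<epsilon>)"
        by (simp add: powr_add)
      also have "ennreal \<dots> * emeasure nu (A (j - m))
          = ennreal C2 * (ennreal ((2 ^ j * lam) powr (q - 1 + \<epsilon>)) * emeasure nu (A (j - m)))"
        using C2 by (simp add: ennreal_mult mult.assoc)
      finally show "?P j \<le> ennreal C2 * (ennreal ((2 ^ j * lam) powr (q - 1 + \<epsilon>)) * emeasure nu (A (j - m)))" .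
    qed
    also have "\<dots> = ennreal C2 * (\<Sum>j\<in>{j0..<J}. ennreal ((2 ^ j * lam) powr (q - 1 + \<epsilon>)) * emeasure nu (A (j - m)))"
      by (rule sum_distrib_left[symmetric])
    also have "(\<Sum>j\<in>{j0..<J}. ennreal ((2 ^ j * lam) powr (q - 1 + \<epsilon>)) * emeasure nu (A (j - m)))
      = (\<integral>\<^sup>+z. (\<Sum>j\<in>{j0..<J}. ennreal ((2 ^ j * lam) powr (q - 1 + \<epsilon>)) * (ennreal (w z) * indicator (A (j - m)) z)) \<partial>lebesgue)"
      unfolding nu_def by (subst nn_integral_sum) (auto simp: nn_integral_cmult emeasure_density)
    also have "\<dots> \<le> (\<integral>\<^sup>+z. ennreal (2 * G / (N0 + 1)) * ennreal (Phi \<epsilon> J z) \<partial>lebesgue)"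
    proof (rule nn_integral_mono)
      fix z
      have "(\<Sum>j\<in>{j0..<J}. ennreal ((2 ^ j * lam) powr (q - 1 + \<epsilon>)) * (ennreal (w z) * indicator (A (j - m)) z))
        = (\<Sum>j\<in>{j0..<J}. ennreal ((2 ^ j * lam) powr (q - 1 + \<epsilon>) * (if z \<in> A (j - m) then w z else 0)))"
        using w_nonneg[of z] by (intro sum.cong) (auto simp: ennreal_mult split: split_indicator)
      also have "\<dots> = ennreal (\<Sum>j\<in>{j0..<J}. (2 ^ j * lam) powr (q - 1 + \<epsilon>) * (if z \<in> A (j - m) then w z else 0))"
        using w_nonneg[of z] by (intro sum_ennreal) auto
      also have "\<dots> \<le> ennreal (2 * G / (N0 + 1) * Phi \<epsilon> J z)"
        unfolding Phi_def j0_def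
      proof (intro ennreal_leI geometric_level_sum[OF q lam N0 eps _ _ w_nonneg G_def])
        show "z \<in> A i" if "i \<le> j" "z \<in> A j" for i j using that A_antimono by blast
        show "2 ^ j * lam < w z" if "z \<in> A j" for j using that by (simp add: A_def)
      qed
      also have "\<dots> = ennreal (2 * G / (N0 + 1)) * ennreal (Phi \<epsilon> J z)"
        using Phi_nonneg by (rule ennreal_mult'')
      finally show "(\<Sum>j\<in>{j0..<J}. ennreal ((2 ^ j * lam) powr (q - 1 + \<epsilon>)) * (ennreal (w z) * indicator (A (j - m)) z))
        \<le> ennreal (2 * G / (N0 + 1)) * ennreal (Phi \<epsilon> J z)" .
    qed
    also have "\<dots> = ennreal (2 * G / (N0 + 1)) * \<Psi>"
    proof -
      have "(\<lambda>z. ennreal (Phi \<epsilon> J z)) \<in> borel_measurable lebesgue"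
        unfolding Phi_def by measurable
      then show ?thesis unfolding \<Psi>_def nn_integral_Phi[symmetric] by (rule nn_integral_cmult)
    qed
    also have "ennreal C2 * (ennreal (2 * G / (N0 + 1)) * \<Psi>) = ennreal (C2 * (2 * G / (N0 + 1))) * \<Psi>"
      by (simp only: ennreal_mult'[OF C2] mult.assoc)
    also have "\<dots> \<le> ennreal (1 / 2) * \<Psi>"
      using small by (intro mult_right_mono ennreal_leI) (auto simp: C2_def G_def)
    finally show ?thesis by (simp add: mult_left_mono)
  qed
  finally have main: "\<Psi> \<le> ennreal (j0 * (2 ^ j0 * lam) powr \<epsilon>) * emeasure mu (V 0) + ennreal (1 / 2) * \<Psi>"
    by (simp add: add_mono)
  \<comment> \<open>Needed before one half of \<open>\<Psi>\<close> may be subtracted.\<close>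
  have "\<Psi> < \<infinity>"
    unfolding \<Psi>_def using fin muA
    by (auto simp: ennreal_mult_less_top intro: le_less_trans)
  then obtain r where r: "\<Psi> = ennreal r" "0 \<le> r" by (cases \<Psi>) auto
  obtain v where v: "emeasure mu (V 0) = ennreal v" "0 \<le> v"
    using fin by (cases "emeasure mu (V 0)") auto
  define x where "x = j0 * (2 ^ j0 * lam) powr \<epsilon>"
  have x: "0 \<le> x" by (simp add: x_def)
  have "ennreal x * ennreal v = ennreal (x * v)" using x v(2) by (rule ennreal_mult[symmetric])
  moreover have "ennreal (1 / 2) * ennreal r = ennreal (1 / 2 * r)"
    using r(2) by (intro ennreal_mult[symmetric]) auto
  moreover have "ennreal (x * v + 1 / 2 * r) = ennreal (x * v) + ennreal (1 / 2 * r)"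
    using x v(2) r(2) by (intro ennreal_plus) auto
  ultimately have "ennreal r \<le> ennreal (x * v + 1 / 2 * r)"
    using main unfolding r(1) v(1) x_def[symmetric] by simp
  then have "r \<le> x * v + 1 / 2 * r" using r(2) v(2) x by (subst (asm) ennreal_le_iff) auto
  then have "r \<le> (2 * x) * v" by simp
  then have "\<Psi> \<le> ennreal (2 * x) * emeasure mu (V 0)"
    unfolding r(1) v(1) using v(2) x by (subst ennreal_mult[symmetric]) (auto intro: ennreal_leI)
  then show ?thesis
    unfolding nn_integral_Phi \<Psi>_def[symmetric] x_def j0_def by (simp only: mult.assoc)
qed

text \<open>Where \<open>w \<le> lam\<close>, the additional power costs only
  \<open>lam powr \<epsilon>\<close>; elsewhere the dyadic level just below \<open>w\<close>
  contributes a single term of \<open>Phi\<close> that already dominates half of w^(q + \<epsilon>).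
  Then \<open>J\<close> tends to infinity by monotone convergence.\<close>

lemma higher_integrability:
  fixes N0 :: nat
  assumes N0: "1 \<le> N0" and eps: "\<epsilon> = 1 / N0"
    and small: "8 * C1 * 3 ^ (CARD('n) + 1) * D * (2 * (2 powr (q * (m + 1)) / (2 powr (q - 1) - 1)) / (N0 + 1)) \<le> 1 / 2"
  shows "(\<integral>\<^sup>+z\<in>lower_part p x0 t0 L. ennreal (w z powr (q + \<epsilon>)) \<partial>lebesgue)
    \<le> ennreal ((1 + 4 * real (N0 + m) * 2 ^ (N0 + m)) * lam powr (q + \<epsilon>) * (L ^ CARD('n) * L powr p))"
proof -
  have e: "0 < \<epsilon>" "\<epsilon> \<le> 1" using N0 eps by auto
  define R where "R = lower_part p x0 t0 L"
  \<comment> \<open>The boxes shrink but never below time \<open>t0\<close>, so on the lower part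
    the level sets are the full ones at every level.\<close>
  have R: "R \<subseteq> V j" for j
  proof -
    have "t0 \<le> height j" using T_pos by (simp add: height_def)
    then show ?thesis by (auto simp: R_def V_def lower_part_def T_def)
  qed
  have Phi_meas [measurable]: "(\<lambda>z. ennreal (Phi \<epsilon> J z)) \<in> borel_measurable lebesgue" for J
    unfolding Phi_def by measurable
  have inc: "incseq (\<lambda>J z. ennreal (Phi \<epsilon> J z))"
    unfolding Phi_def by (auto simp: incseq_def le_fun_def intro!: ennreal_leI sum_mono2)
  have pw: "ennreal (w z powr (q + \<epsilon>)) * indicator R z
      \<le> ennreal (lam powr \<epsilon>) * (ennreal (w z powr q) * indicator (V 0) z) + 2 * (SUP J. ennreal (Phi \<epsilon> J z))" for z
  proof (cases "z \<in> R")
    case True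
    then have z0: "z \<in> V 0" using R by blast
    show ?thesis
    proof (cases "w z \<le> lam")
      case True
      then have "w z powr (q + \<epsilon>) \<le> lam powr \<epsilon> * w z powr q"
        using w_nonneg[of z] e by (simp add: powr_add mult.commute mult_right_mono powr_mono2)
      then have "ennreal (w z powr (q + \<epsilon>)) \<le> ennreal (lam powr \<epsilon>) * ennreal (w z powr q)"
        by (simp add: ennreal_leI flip: ennreal_mult)
      then show ?thesis using z0 \<open>z \<in> R\<close> by (simp add: add_increasing2)
    next
      case False
      obtain n0 where "w z / lam < 2 ^ n0" using real_arch_pow[of 2 "w z / lam"] by auto
      then have ex: "w z \<le> 2 ^ n0 * lam" using lam by (simp add: field_simps)
      \<comment> \<open>The predecessor \<open>M\<close> of \<open>n\<close> satisfies
        \<open>2 ^ M * lam < w z \<le> 2 * (2 ^ M * lam)\<close>.\<close>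
      define n where "n = (LEAST n. w z \<le> 2 ^ n * lam)"
      have n: "w z \<le> 2 ^ n * lam" unfolding n_def by (rule LeastI[where P = "\<lambda>n. w z \<le> 2 ^ n * lam", OF ex])
      then have "n \<noteq> 0" using False by (cases n) auto
      then obtain M where M: "n = Suc M" by (cases n) auto
      then have wM: "2 ^ M * lam < w z"
        using not_less_Least[of M "\<lambda>n. w z \<le> 2 ^ n * lam"] unfolding n_def by auto
      have zM: "z \<in> A M" using \<open>z \<in> R\<close> R wM by (auto simp: A_def)
      have "w z powr \<epsilon> \<le> (2 * (2 ^ M * lam)) powr \<epsilon>"
        using n M w_nonneg[of z] e by (intro powr_mono2) (auto simp: mult.assoc)
      also have "\<dots> = 2 powr \<epsilon> * (2 ^ M * lam) powr \<epsilon>" using lam by (simp add: powr_mult)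
      also have "\<dots> \<le> 2 powr 1 * (2 ^ M * lam) powr \<epsilon>" using e by (intro mult_right_mono powr_mono) auto
      finally have "w z powr \<epsilon> * w z powr q \<le> 2 powr 1 * (2 ^ M * lam) powr \<epsilon> * w z powr q"
        by (rule mult_right_mono) simp
      then have "w z powr (q + \<epsilon>) \<le> 2 * ((2 ^ M * lam) powr \<epsilon> * w z powr q)"
        by (simp add: powr_add mult_ac)
      also have "(2 ^ M * lam) powr \<epsilon> * w z powr q \<le> Phi \<epsilon> (Suc M) z"
        using zM Phi_nonneg[of \<epsilon> M z] by (simp add: Phi_def)
      finally have "ennreal (w z powr (q + \<epsilon>)) \<le> ennreal (2 * Phi \<epsilon> (Suc M) z)"
        by (intro ennreal_leI) auto
      also have "\<dots> = 2 * ennreal (Phi \<epsilon> (Suc M) z)"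
        using Phi_nonneg by (simp add: ennreal_mult)
      also have "\<dots> \<le> 2 * (SUP J. ennreal (Phi \<epsilon> J z))"
        by (intro mult_left_mono SUP_upper) auto
      finally show ?thesis using \<open>z \<in> R\<close> by (simp add: add_increasing)
    qed
  qed simp
  have "(\<integral>\<^sup>+z. ennreal (w z powr (q + \<epsilon>)) * indicator R z \<partial>lebesgue)
    \<le> (\<integral>\<^sup>+z. ennreal (lam powr \<epsilon>) * (ennreal (w z powr q) * indicator (V 0) z) + 2 * (SUP J. ennreal (Phi \<epsilon> J z)) \<partial>lebesgue)"
    using pw by (rule nn_integral_mono)
  also have "\<dots> = ennreal (lam powr \<epsilon>) * emeasure mu (V 0) + 2 * (\<integral>\<^sup>+z. (SUP J. ennreal (Phi \<epsilon> J z)) \<partial>lebesgue)"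
    unfolding mu_def by (subst nn_integral_add) (auto simp: nn_integral_cmult emeasure_density)
  also have "(\<integral>\<^sup>+z. (SUP J. ennreal (Phi \<epsilon> J z)) \<partial>lebesgue) = (SUP J. \<integral>\<^sup>+z. ennreal (Phi \<epsilon> J z) \<partial>lebesgue)"
    using inc by (rule nn_integral_monotone_convergence_SUP) simp
  also have "\<dots> \<le> ennreal (2 * real (N0 + m) * (2 ^ (N0 + m) * lam) powr \<epsilon>) * emeasure mu (V 0)"
    by (intro SUP_least Phi_bound assms)
  also have "ennreal (lam powr \<epsilon>) * emeasure mu (V 0)
      + 2 * (ennreal (2 * real (N0 + m) * (2 ^ (N0 + m) * lam) powr \<epsilon>) * emeasure mu (V 0))
    = ennreal (lam powr \<epsilon> + 4 * real (N0 + m) * (2 ^ (N0 + m) * lam) powr \<epsilon>) * emeasure mu (V 0)"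
  proof -
    have "2 * (ennreal (2 * real (N0 + m) * (2 ^ (N0 + m) * lam) powr \<epsilon>) * emeasure mu (V 0))
      = ennreal (2 * (2 * real (N0 + m) * (2 ^ (N0 + m) * lam) powr \<epsilon>)) * emeasure mu (V 0)"
      by (subst ennreal_mult) (auto simp: mult.assoc)
    then show ?thesis by (subst ennreal_plus) (auto simp: distrib_right mult.assoc)
  qed
  also have "\<dots> \<le> ennreal ((1 + 4 * real (N0 + m) * 2 ^ (N0 + m)) * lam powr \<epsilon>) *
      ennreal (lam powr q * (L ^ CARD('n) * L powr p))"
  proof (intro mult_mono ennreal_leI)
    have "(2 ^ (N0 + m) * lam) powr \<epsilon> = (2 ^ (N0 + m)) powr \<epsilon> * lam powr \<epsilon>"
      using lam by (simp add: powr_mult)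
    also have "\<dots> \<le> 2 ^ (N0 + m) * lam powr \<epsilon>"
    proof (intro mult_right_mono)
      have "(2 ^ (N0 + m)) powr \<epsilon> \<le> (2 ^ (N0 + m) :: real) powr 1"
        using e by (intro powr_mono) auto
      then show "(2 ^ (N0 + m)) powr \<epsilon> \<le> (2 ^ (N0 + m) :: real)" by simp
    qed simp
    finally have "4 * real (N0 + m) * (2 ^ (N0 + m) * lam) powr \<epsilon> \<le> 4 * real (N0 + m) * (2 ^ (N0 + m) * lam powr \<epsilon>)"
      by (intro mult_left_mono) auto
    then show "lam powr \<epsilon> + 4 * real (N0 + m) * (2 ^ (N0 + m) * lam) powr \<epsilon>
        \<le> (1 + 4 * real (N0 + m) * 2 ^ (N0 + m)) * lam powr \<epsilon>"
      by (simp only: distrib_right mult_1 mult.assoc)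
    have "len k0 \<le> L" "h k0 \<le> T"
      using L T_pos by (auto simp: len_def h_def field_simps)
    then have "len k0 ^ CARD('n) * h k0 \<le> L ^ CARD('n) * L powr p"
      using L len_pos[of k0] h_pos[of k0] unfolding T_def by (intro mult_mono power_mono) auto
    then show "emeasure mu (V 0) \<le> ennreal (lam powr q * (L ^ CARD('n) * L powr p))"
      by (intro order_trans[OF mu_V0] ennreal_leI mult_left_mono) auto
  qed auto
  also have "\<dots> = ennreal ((1 + 4 * real (N0 + m) * 2 ^ (N0 + m)) * lam powr (q + \<epsilon>) * (L ^ CARD('n) * L powr p))"
    using L by (subst ennreal_mult[symmetric]) (auto simp: powr_add mult_ac)
  finally show ?thesis by (simp add: R_def add_left_mono mult_left_mono)
qed

end

section \<open>Gehring's lemma\<close>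

text \<open>Integrability is given on compact sets only; the function is the pointwise limit of its
  cut-offs to balls.\<close>

lemma weight_borel_measurable:
  assumes "weight w"
  shows "w \<in> borel_measurable lebesgue"
proof (rule borel_measurable_LIMSEQ_real)
  show "(\<lambda>n. indicat_real (cball 0 (real n)) z * w z) \<longlonglongrightarrow> w z" for z
  proof (rule tendsto_eventually)
    obtain n0 :: nat where "norm z \<le> real n0" using real_arch_simple by blast
    then show "\<forall>\<^sub>F n in sequentially. indicat_real (cball 0 (real n)) z * w z = w z"
      by (intro eventually_sequentiallyI[of n0]) auto
  qed
  show "(\<lambda>z. indicat_real (cball 0 (real n)) z * w z) \<in> borel_measurable lebesgue" for n
  proof -
    have "set_integrable lebesgue (cball 0 (real n)) w"
      using assms compact_cball unfolding weight_def by blast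
    then show ?thesis
      unfolding set_integrable_def real_scaleR_def by (rule borel_measurable_integrable)
  qed
qed

lemma upper_part_mass_finite:
  fixes w :: "(real ^ 'n) \<times> real \<Rightarrow> real"
  assumes w: "weight w"
  shows "emeasure (density lebesgue (\<lambda>z. ennreal (w z))) (upper_part p x t l) < \<infinity>"
proof -
  have [measurable]: "w \<in> borel_measurable lebesgue" using w by (rule weight_borel_measurable)
  let ?K = "cube x l \<times> {t .. t + l powr p}"
  have "compact ?K" by (simp add: cube_eq_cbox compact_Times)
  then have int: "integrable lebesgue (\<lambda>z. indicat_real ?K z * w z)"
    using w unfolding weight_def set_integrable_def by simp
  have "emeasure (density lebesgue (\<lambda>z. ennreal (w z))) (upper_part p x t l)
    = (\<integral>\<^sup>+z. ennreal (w z) * indicator (upper_part p x t l) z \<partial>lebesgue)"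
    by (rule emeasure_density) auto
  also have "\<dots> \<le> (\<integral>\<^sup>+z. ennreal (norm (indicat_real ?K z * w z)) \<partial>lebesgue)"
    using w by (intro nn_integral_mono) (auto simp: weight_def upper_part_def split: split_indicator)
  also have "\<dots> < \<infinity>" using int by (simp add: integrable_iff_bounded)
  finally show ?thesis .
qed

lemma average_eq:
  assumes "0 < r" "emeasure lebesgue S = ennreal r"
    and [measurable]: "f \<in> borel_measurable lebesgue" "S \<in> sets lebesgue"
    and "emeasure (density lebesgue (\<lambda>z. ennreal (f z))) S = ennreal (a * r)" "0 \<le> a"
  shows "average S f = ennreal a"
proof -
  have "average S f = ennreal (a * r) / ennreal r"
    unfolding average_def assms(2) assms(5)[symmetric] by (subst emeasure_density) auto
  also have "\<dots> = ennreal a" using assms(1,6) by (subst divide_ennreal) auto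
  finally show ?thesis .
qed

text \<open>The right-hand average is finite by local integrability, and \<open>ennreal_powr\<close>
  sends infinity to infinity, so the hypothesis itself excludes infinite mass of w^q on the lower
  part.\<close>

lemma reverse_hoelder_mass:
  fixes w :: "(real ^ 'n) \<times> real \<Rightarrow> real"
  assumes w: "weight w" and q: "0 < q" and C1: "0 < C1" and l: "0 < l"
    and rh: "ennreal_powr (average (lower_part p x t l) (\<lambda>z. w z powr q)) (1 / q)
        \<le> ennreal C1 * average (upper_part p x t l) w"
  shows "\<exists>a\<ge>0. emeasure (density lebesgue (\<lambda>z. ennreal (w z))) (upper_part p x t l)
        = ennreal (a * (l ^ CARD('n) * l powr p)) \<and>
      emeasure (density lebesgue (\<lambda>z. ennreal (w z powr q))) (lower_part p x t l)
        \<le> ennreal ((C1 * a) powr q * (l ^ CARD('n) * l powr p))"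
proof -
  have [measurable]: "w \<in> borel_measurable lebesgue" using w by (rule weight_borel_measurable)
  let ?r = "l ^ CARD('n) * l powr p"
  let ?mu = "density lebesgue (\<lambda>z. ennreal (w z powr q))"
  have r: "0 < ?r" using l by simp
  obtain I where I: "0 \<le> I" "emeasure (density lebesgue (\<lambda>z. ennreal (w z))) (upper_part p x t l) = ennreal I"
    using upper_part_mass_finite[OF w, of p x t l]
    by (cases "emeasure (density lebesgue (\<lambda>z. ennreal (w z))) (upper_part p x t l)") auto
  define a where "a = I / ?r"
  have a: "0 \<le> a" "I = a * ?r" using I(1) r by (auto simp: a_def)
  have "average (upper_part p x t l) w = ennreal a"
    using r I a l by (intro average_eq[of ?r]) (auto simp: emeasure_upper_part)
  then have rh': "ennreal_powr (average (lower_part p x t l) (\<lambda>z. w z powr q)) (1 / q) \<le> ennreal (C1 * a)"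
    using rh C1 a by (simp add: ennreal_mult)
  have av: "average (lower_part p x t l) (\<lambda>z. w z powr q) = emeasure ?mu (lower_part p x t l) / ennreal ?r"
    unfolding average_def using l by (subst emeasure_density) (auto simp: emeasure_lower_part)
  have "emeasure ?mu (lower_part p x t l) \<noteq> \<infinity>"
  proof
    assume "emeasure ?mu (lower_part p x t l) = \<infinity>"
    then have "average (lower_part p x t l) (\<lambda>z. w z powr q) = \<infinity>"
      unfolding av by (simp add: ennreal_top_divide)
    then show False using rh' by (simp add: ennreal_powr_def top_unique)
  qed
  then obtain u where u: "0 \<le> u" "emeasure ?mu (lower_part p x t l) = ennreal u"
    by (cases "emeasure ?mu (lower_part p x t l)") auto
  have "average (lower_part p x t l) (\<lambda>z. w z powr q) = ennreal (u / ?r)"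
    unfolding av u(2) using u(1) r by (rule divide_ennreal)
  then have "ennreal ((u / ?r) powr (1 / q)) \<le> ennreal (C1 * a)"
    using rh' u(1) r by (simp add: ennreal_powr_def)
  then have "(u / ?r) powr (1 / q) \<le> C1 * a" using C1 a(1) by (subst (asm) ennreal_le_iff) auto
  then have "((u / ?r) powr (1 / q)) powr q \<le> (C1 * a) powr q" using q by (intro powr_mono2) auto
  moreover have "((u / ?r) powr (1 / q)) powr q = u / ?r" using q u(1) r by (simp add: powr_powr)
  ultimately have "u \<le> (C1 * a) powr q * ?r" using r by (simp add: pos_divide_le_eq)
  then show ?thesis using a I u by (intro exI[of _ a]) (auto intro: ennreal_leI)
qed

theorem theorem4p2:
  fixes p q C1 :: real
  assumes "1 \<le> p" and "1 < q" and "0 < C1"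
  shows "\<exists>\<epsilon>>0. \<exists>C>0. \<forall>w :: (real ^ 'n) \<times> real \<Rightarrow> real.
    weight w \<longrightarrow>
    (\<forall>x t L. 0 < L \<longrightarrow>
      ennreal_powr (average (lower_part p x t L) (\<lambda>z. w z powr q)) (1 / q)
        \<le> ennreal C1 * average (upper_part p x t L) w) \<longrightarrow>
    (\<forall>x t L. 0 < L \<longrightarrow>
      ennreal_powr (average (lower_part p x t L) (\<lambda>z. w z powr (q + \<epsilon>))) (1 / (q + \<epsilon>))
        \<le> ennreal C * average (upper_part p x t L) w)"
proof -
  \<comment> \<open>All constants, up to \<open>C\<close>, are fixed here from n, p, q and
    \<open>C1\<close>, before any weight is introduced.\<close>
  define b where "b = q / (CARD('n) + nat \<lceil>p\<rceil>)"
  have "0 < b" using \<open>1 < q\<close> by (simp add: b_def add_pos_nonneg)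
  then have "2 powr (- b) < 2 powr (0::real)" by (subst powr_less_cancel_iff) auto
  then have v: "0 < 1 - 2 powr (- b)" by simp
  obtain k0 :: nat where "4 / (1 - 2 powr (- b)) < 2 ^ k0"
    using real_arch_pow[of 2 "4 / (1 - 2 powr (- b))"] by auto
  then have k0: "4 / 2 ^ k0 \<le> 1 - 2 powr (- b)" using v by (simp add: field_simps)
  have "4 / 2 ^ k0 < (1::real)" using k0 by (rule le_less_trans) simp
  then have "(2::real) ^ 2 < 2 ^ k0" by (simp add: field_simps)
  then have k0_2: "2 \<le> k0" using power_strict_increasing_iff[of "2::real" 2 k0] by simp
  obtain m0 :: nat where "8 * C1 < 2 ^ m0" using real_arch_pow[of 2 "8 * C1"] by auto
  moreover define m where "m = Suc m0"
  ultimately have m: "1 \<le> m" "8 * C1 \<le> 2 ^ m" using \<open>0 < C1\<close> by auto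
  \<comment> \<open>\<open>X / (N0 + 1)\<close> is the factor in front of the absorbed term.\<close>
  define X where "X = 8 * C1 * 3 ^ (CARD('n) + 1) * 2 ^ (CARD('n) + nat \<lceil>p\<rceil>) * (2 * (2 powr (q * (m + 1)) / (2 powr (q - 1) - 1)))"
  obtain N0' :: nat where "2 * X \<le> real N0'" using real_arch_simple by blast
  moreover define N0 where "N0 = Suc N0'"
  ultimately have "X / (N0 + 1) \<le> 1 / 2" by (simp add: field_simps)
  then have N0: "1 \<le> N0" "8 * C1 * 3 ^ (CARD('n) + 1) * 2 ^ (CARD('n) + nat \<lceil>p\<rceil>) *
      (2 * (2 powr (q * (m + 1)) / (2 powr (q - 1) - 1)) / (N0 + 1)) \<le> 1 / 2"
    by (auto simp: X_def N0_def)
  define \<epsilon> where "\<epsilon> = 1 / real N0"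
  have e: "0 < \<epsilon>" using N0 by (simp add: \<epsilon>_def)
  define B0 where "B0 = 1 + 4 * real (N0 + m) * 2 ^ (N0 + m)"
  have B0: "0 < B0" by (simp add: B0_def add_pos_nonneg)
  \<comment> \<open>The factor of \<open>initial_mass\<close> times the volume ratio of R^- to a
    cell of generation \<open>k0\<close>; the last exponent is \<open>N k0\<close>. Thus
    \<open>lam = K0 * \<alpha>\<close> would just meet the assumption \<open>mass\<close>.\<close>
  define K1 where "K1 = (1 + 8 * ((2 ^ k0) ^ CARD('n) * 2 powr (p * k0)) powr q) * C1 powr q
    * (2 ^ k0) ^ CARD('n) * 2 ^ (nat \<lceil>p * k0\<rceil> + 1)"
  have K1: "0 < K1" using \<open>0 < C1\<close> by (simp add: K1_def add_pos_nonneg)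
  define K0 where "K0 = K1 powr (1 / q)"
  have K0: "0 < K0" "K0 powr q = K1"
    using K1 \<open>1 < q\<close> by (auto simp: K0_def powr_powr)
  define C where "C = B0 powr (1 / (q + \<epsilon>)) * K0"
  have C: "0 < C" using B0 K0 by (simp add: C_def)
  have main: "ennreal_powr (average (lower_part p x t L) (\<lambda>z. w z powr (q + \<epsilon>))) (1 / (q + \<epsilon>))
        \<le> ennreal C * average (upper_part p x t L) w"
    if w: "weight w" and L: "0 < L"
      and rh: "\<forall>x t L. 0 < L \<longrightarrow>
        ennreal_powr (average (lower_part p x t L) (\<lambda>z. w z powr q)) (1 / q)
          \<le> ennreal C1 * average (upper_part p x t L) w"
    for w :: "(real ^ 'n) \<times> real \<Rightarrow> real" and x t L
  proof -
    have w_meas [measurable]: "w \<in> borel_measurable lebesgue" using w by (rule weight_borel_measurable)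
    have mass: "\<exists>a\<ge>0. emeasure (density lebesgue (\<lambda>z. ennreal (w z))) (upper_part p x t l)
        = ennreal (a * (l ^ CARD('n) * l powr p)) \<and>
      emeasure (density lebesgue (\<lambda>z. ennreal (w z powr q))) (lower_part p x t l)
        \<le> ennreal ((C1 * a) powr q * (l ^ CARD('n) * l powr p))" if "0 < l" for l x t
      using reverse_hoelder_mass[OF w _ \<open>0 < C1\<close> that] rh that \<open>1 < q\<close> by simp
    interpret reverse_hoelder p L t x w q C1
      by unfold_locales (use assms L w mass in \<open>auto simp: weight_def\<close>)
    let ?R = "L ^ CARD('n) * T"
    have R: "0 < ?R" using L T_pos by simp
    obtain \<alpha> where \<alpha>: "0 \<le> \<alpha>" "emeasure nu (upper_part p x t L) = ennreal (\<alpha> * ?R)"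
      using mass[OF L, of x t] unfolding nu_def T_def by blast
    have av_up: "average (upper_part p x t L) w = ennreal \<alpha>"
      using R \<alpha> L by (intro average_eq[of ?R]) (auto simp: emeasure_upper_part T_def nu_def)
    let ?avg = "average (lower_part p x t L) (\<lambda>z. w z powr (q + \<epsilon>))"
    \<comment> \<open>The base level must be positive while \<open>\<alpha>\<close> may vanish,
      hence the shift by \<open>\<eta>\<close>.\<close>
    have bound: "?avg \<le> ennreal (B0 * (K0 * \<alpha> + \<eta>) powr (q + \<epsilon>))" if \<eta>: "0 < \<eta>" for \<eta>
    proof -
      define lam where "lam = K0 * \<alpha> + \<eta>"
      have lam: "0 < lam" using \<eta> K0 \<alpha>(1) by (simp add: lam_def add_nonneg_pos)
      have "emeasure mu (cube x L \<times> {t - T <..< t + T / 2})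
          \<le> ennreal ((1 + 8 * ((2 ^ k0) ^ CARD('n) * 2 powr (p * k0)) powr q) * (C1 * \<alpha>) powr q * ?R)"
        using initial_mass[OF k0_2 \<alpha>] .
      also have "\<dots> \<le> ennreal (lam powr q * (len k0 ^ CARD('n) * h k0))"
      proof (rule ennreal_leI)
        have "(1 + 8 * ((2 ^ k0) ^ CARD('n) * 2 powr (p * k0)) powr q) * (C1 * \<alpha>) powr q * ?R
            = K1 * \<alpha> powr q * (len k0 ^ CARD('n) * h k0)"
          using \<open>0 < C1\<close> \<alpha>(1) unfolding K1_def len_def h_def N_def
          by (simp add: powr_mult power_divide)
        also have "\<dots> = (K0 * \<alpha>) powr q * (len k0 ^ CARD('n) * h k0)"
          using K0 \<alpha>(1) by (simp add: powr_mult)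
        also have "\<dots> \<le> lam powr q * (len k0 ^ CARD('n) * h k0)"
          using K0 \<alpha>(1) \<eta> \<open>1 < q\<close> len_pos[of k0] h_pos[of k0]
          by (intro mult_right_mono powr_mono2) (auto simp: lam_def)
        finally show "(1 + 8 * ((2 ^ k0) ^ CARD('n) * 2 powr (p * k0)) powr q) * (C1 * \<alpha>) powr q * ?R
            \<le> lam powr q * (len k0 ^ CARD('n) * h k0)" .
      qed
      finally have mass0: "emeasure mu (cube x L \<times> {t - T <..< t + T / 2})
          \<le> ennreal (lam powr q * (len k0 ^ CARD('n) * h k0))" .
      interpret gehring p L t x w q C1 lam b k0 m
        by unfold_locales (use lam b_def k0 m mass0 in auto)
      have "(\<integral>\<^sup>+z\<in>lower_part p x t L. ennreal (w z powr (q + \<epsilon>)) \<partial>lebesgue)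
          \<le> ennreal (B0 * lam powr (q + \<epsilon>) * (L ^ CARD('n) * L powr p))"
        unfolding B0_def
        by (rule higher_integrability[OF N0(1) \<epsilon>_def]) (use N0(2) in \<open>simp add: D_def\<close>)
      then have "?avg \<le> ennreal (B0 * lam powr (q + \<epsilon>) * ?R) / ennreal ?R"
        unfolding average_def T_def using L by (simp add: emeasure_lower_part divide_right_mono_ennreal)
      also have "\<dots> = ennreal (B0 * lam powr (q + \<epsilon>))"
        using R B0 L by (subst divide_ennreal) auto
      finally show ?thesis by (simp add: lam_def)
    qed
    have "?avg < \<infinity>" using bound[of 1] by (rule le_less_trans) auto
    then obtain y where y: "0 \<le> y" "?avg = ennreal y" by (cases ?avg) auto
    have "y powr (1 / (q + \<epsilon>)) \<le> C * \<alpha>"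
    proof (rule field_le_epsilon)
      fix d :: real assume d: "0 < d"
      \<comment> \<open>The choice \<open>\<eta> = d / B1\<close> produces an error of exactly
        \<open>d\<close> after the root is taken.\<close>
      define B1 where "B1 = B0 powr (1 / (q + \<epsilon>))"
      have B1: "0 < B1" using B0 by (simp add: B1_def)
      have "0 < d / B1" using d B1 by simp
      then have "y \<le> B0 * (K0 * \<alpha> + d / B1) powr (q + \<epsilon>)"
        using bound[of "d / B1"] y B0 by (simp add: ennreal_le_iff)
      then have "y powr (1 / (q + \<epsilon>)) \<le> (B0 * (K0 * \<alpha> + d / B1) powr (q + \<epsilon>)) powr (1 / (q + \<epsilon>))"
        using y(1) \<open>1 < q\<close> e by (intro powr_mono2) auto
      also have "\<dots> = B1 * (K0 * \<alpha> + d / B1)"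
        using B0 K0 \<alpha>(1) \<open>0 < d / B1\<close> \<open>1 < q\<close> e by (simp add: powr_mult powr_powr B1_def)
      also have "\<dots> = C * \<alpha> + d" using B1 by (simp add: C_def B1_def[symmetric] distrib_left)
      finally show "y powr (1 / (q + \<epsilon>)) \<le> C * \<alpha> + d" .
    qed
    then have "ennreal_powr ?avg (1 / (q + \<epsilon>)) \<le> ennreal (C * \<alpha>)"
      unfolding y(2) ennreal_powr_def using y(1) by (simp add: ennreal_leI)
    also have "\<dots> = ennreal C * average (upper_part p x t L) w"
      unfolding av_up using C \<alpha>(1) by (intro ennreal_mult) auto
    finally show ?thesis .
  qed
  show ?thesis
    using e C main by (intro exI[of _ \<epsilon>] exI[of _ C] conjI allI impI) auto
qed

end
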